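(* Let $H$ be an affine Hopf algebra over a field $\Bbbk$. If the Hopf coradical $H_{[0]}$ of $H$ is a Hopf subalgebra of $H$ (equivalently, $S_H(H_{[0]})\subseteq H_{[0]}$, where $S_H$ is the antipode of $H$), then $H_{[0]}$ is affine.
   Context: A $\Bbbk$-algebra is called affine if it is finitely generated as a $\Bbbk$-algebra. The coradical $H_{(0)}$ of a Hopf algebra $H$ is the sum of all simple subcoalgebras of $H$. The Hopf coradical $H_{[0]}$ is the subalgebra of $H$ generated by $H_{(0)}$. The field $\Bbbk$ is arbitrary. *)

theory Defs
  imports Complex_Main "HOL-Library.Poly_Mapping"
begin

section \<open>Free vector spaces and tensor products\<close>

text \<open>
  The free vector space on a type \<open>'x\<close> over the field \<open>'k\<close> is the type \<open>'x \<Rightarrow>\<^sub>0 'k\<close> of finitely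
  supported functions.
\<close>

definition fscale :: "'k::field \<Rightarrow> ('x \<Rightarrow>\<^sub>0 'k) \<Rightarrow> ('x \<Rightarrow>\<^sub>0 'k)" where
  "fscale c u = Poly_Mapping.map (\<lambda>d. c * d) u"

definition gen :: "'x \<Rightarrow> ('x \<Rightarrow>\<^sub>0 'k::field)" where
  "gen x = Poly_Mapping.single x 1"

definition lin_ext :: "('k::field \<Rightarrow> 'v::ab_group_add \<Rightarrow> 'v) \<Rightarrow> ('x \<Rightarrow> 'v) \<Rightarrow> ('x \<Rightarrow>\<^sub>0 'k) \<Rightarrow> 'v" where
  "lin_ext s f u = (\<Sum>x\<in>Poly_Mapping.keys u. s (Poly_Mapping.lookup u x) (f x))"

lemma lookup_fscale: "Poly_Mapping.lookup (fscale c u) x = c * Poly_Mapping.lookup u x"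
  by (simp add: fscale_def Poly_Mapping.map.rep_eq when_def)

lemma vector_space_fscale: "vector_space (fscale :: 'k::field \<Rightarrow> ('x \<Rightarrow>\<^sub>0 'k) \<Rightarrow> ('x \<Rightarrow>\<^sub>0 'k))"
  by (rule vector_space.intro)
    (auto intro!: poly_mapping_eqI simp: lookup_fscale lookup_add algebra_simps)

text \<open>
  For a vector space \<open>V\<close> with underlying type \<open>'v\<close> and scalar multiplication \<open>s\<close>, the tensor
  product \<open>V \<otimes> V\<close> is the free vector space on \<open>'v \<times> 'v\<close> modulo the subspace \<open>tensor2_rel s\<close>;
  its elements are the cosets \<open>tensor2_class s u\<close>, and \<open>x \<otimes> y\<close> is the coset of \<open>gen (x, y)\<close>.
  Similarly, \<open>V \<otimes> V \<otimes> V\<close> is the free vector space on triples modulo \<open>tensor3_rel s\<close>.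
\<close>

definition tensor2_rel :: "('k::field \<Rightarrow> 'v::ab_group_add \<Rightarrow> 'v) \<Rightarrow> (('v \<times> 'v) \<Rightarrow>\<^sub>0 'k) set" where
  "tensor2_rel s = module.span fscale
    ({gen (x + x', y) - gen (x, y) - gen (x', y) | x x' y. True} \<union>
     {gen (x, y + y') - gen (x, y) - gen (x, y') | x y y'. True} \<union>
     {gen (s c x, y) - fscale c (gen (x, y)) | c x y. True} \<union>
     {gen (x, s c y) - fscale c (gen (x, y)) | c x y. True})"

definition tensor3_rel ::
    "('k::field \<Rightarrow> 'v::ab_group_add \<Rightarrow> 'v) \<Rightarrow> (('v \<times> 'v \<times> 'v) \<Rightarrow>\<^sub>0 'k) set" where
  "tensor3_rel s = module.span fscale
    ({gen (x + x', y, z) - gen (x, y, z) - gen (x', y, z) | x x' y z. True} \<union>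
     {gen (x, y + y', z) - gen (x, y, z) - gen (x, y', z) | x y y' z. True} \<union>
     {gen (x, y, z + z') - gen (x, y, z) - gen (x, y, z') | x y z z'. True} \<union>
     {gen (s c x, y, z) - fscale c (gen (x, y, z)) | c x y z. True} \<union>
     {gen (x, s c y, z) - fscale c (gen (x, y, z)) | c x y z. True} \<union>
     {gen (x, y, s c z) - fscale c (gen (x, y, z)) | c x y z. True})"

definition tensor2_class ::
    "('k::field \<Rightarrow> 'v::ab_group_add \<Rightarrow> 'v) \<Rightarrow> (('v \<times> 'v) \<Rightarrow>\<^sub>0 'k) \<Rightarrow> (('v \<times> 'v) \<Rightarrow>\<^sub>0 'k) set" where
  "tensor2_class s u = {v. v - u \<in> tensor2_rel s}"

section \<open>Algebras, coalgebras and Hopf algebras over a field\<close>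

locale algebra = vector_space scale
  for scale :: "'k::field \<Rightarrow> 'h::ring_1 \<Rightarrow> 'h" +
  assumes scale_mult_left: "scale c x * y = scale c (x * y)"
    and mult_scale_right: "x * scale c y = scale c (x * y)"

text \<open>
  A comultiplication \<open>\<Delta>\<close> sends \<open>x\<close> to an element of the tensor square, that is, to a coset;
  \<open>u \<in> \<Delta> x\<close> says that the formal sum \<open>u\<close> is an expression \<open>\<Sum> x\<^sub>1 \<otimes> x\<^sub>2\<close> for \<open>\<Delta> x\<close>.
  Since \<open>\<Delta>\<close> is linear, the identities below do not depend on the expressions chosen;
  in \<open>coassoc\<close>, \<open>d\<close> chooses one for each element.
\<close>

locale coalgebra = vector_space scale
  for scale :: "'k::field \<Rightarrow> 'h::ab_group_add \<Rightarrow> 'h" +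
  fixes \<Delta> :: "'h \<Rightarrow> (('h \<times> 'h) \<Rightarrow>\<^sub>0 'k) set"
    and \<epsilon> :: "'h \<Rightarrow> 'k"
  assumes comult_tensor: "\<exists>u. \<Delta> x = tensor2_class scale u"
    and comult_add: "u \<in> \<Delta> x \<Longrightarrow> v \<in> \<Delta> y \<Longrightarrow> u + v \<in> \<Delta> (x + y)"
    and comult_scale: "u \<in> \<Delta> x \<Longrightarrow> fscale c u \<in> \<Delta> (scale c x)"
    and counit_linear: "Vector_Spaces.linear scale (*) \<epsilon>"
    and coassoc: "u \<in> \<Delta> x \<Longrightarrow> (\<And>y. d y \<in> \<Delta> y) \<Longrightarrow>
      lin_ext fscale (\<lambda>(a, b). lin_ext fscale (\<lambda>(a1, a2). gen (a1, a2, b)) (d a)) u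
      - lin_ext fscale (\<lambda>(a, b). lin_ext fscale (\<lambda>(b1, b2). gen (a, b1, b2)) (d b)) u
      \<in> tensor3_rel scale"
    and counit_left: "u \<in> \<Delta> x \<Longrightarrow> lin_ext scale (\<lambda>(a, b). scale (\<epsilon> a) b) u = x"
    and counit_right: "u \<in> \<Delta> x \<Longrightarrow> lin_ext scale (\<lambda>(a, b). scale (\<epsilon> b) a) u = x"

text \<open>The product \<open>(a \<otimes> b)(c \<otimes> d) = ac \<otimes> bd\<close>, on formal sums.\<close>

definition tensor2_mult ::
    "(('h \<times> 'h) \<Rightarrow>\<^sub>0 'k::field) \<Rightarrow> (('h \<times> 'h) \<Rightarrow>\<^sub>0 'k) \<Rightarrow> (('h::ring_1 \<times> 'h) \<Rightarrow>\<^sub>0 'k)" where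
  "tensor2_mult u v =
    lin_ext fscale (\<lambda>(a, b). lin_ext fscale (\<lambda>(c, d). gen (a * c, b * d)) v) u"

locale bialgebra = algebra scale + coalgebra scale \<Delta> \<epsilon>
  for scale :: "'k::field \<Rightarrow> 'h::ring_1 \<Rightarrow> 'h"
    and \<Delta> :: "'h \<Rightarrow> (('h \<times> 'h) \<Rightarrow>\<^sub>0 'k) set"
    and \<epsilon> :: "'h \<Rightarrow> 'k" +
  assumes comult_one: "gen (1, 1) \<in> \<Delta> 1"
    and comult_mult: "u \<in> \<Delta> x \<Longrightarrow> v \<in> \<Delta> y \<Longrightarrow> tensor2_mult u v \<in> \<Delta> (x * y)"
    and counit_one: "\<epsilon> 1 = 1"
    and counit_mult: "\<epsilon> (x * y) = \<epsilon> x * \<epsilon> y"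

locale hopf_algebra = bialgebra scale \<Delta> \<epsilon>
  for scale :: "'k::field \<Rightarrow> 'h::ring_1 \<Rightarrow> 'h"
    and \<Delta> :: "'h \<Rightarrow> (('h \<times> 'h) \<Rightarrow>\<^sub>0 'k) set"
    and \<epsilon> :: "'h \<Rightarrow> 'k" +
  fixes S :: "'h \<Rightarrow> 'h"
  assumes antipode_linear: "Vector_Spaces.linear scale scale S"
    and antipode_left: "u \<in> \<Delta> x \<Longrightarrow> lin_ext scale (\<lambda>(a, b). S a * b) u = scale (\<epsilon> x) 1"
    and antipode_right: "u \<in> \<Delta> x \<Longrightarrow> lin_ext scale (\<lambda>(a, b). a * S b) u = scale (\<epsilon> x) 1"

section \<open>Subalgebras and affine algebras\<close>

definition subalgebra :: "('k::field \<Rightarrow> 'h::ring_1 \<Rightarrow> 'h) \<Rightarrow> 'h set \<Rightarrow> bool" where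
  "subalgebra scale A \<longleftrightarrow>
    module.subspace scale A \<and> 1 \<in> A \<and> (\<forall>x\<in>A. \<forall>y\<in>A. x * y \<in> A)"

definition generated_subalgebra :: "('k::field \<Rightarrow> 'h::ring_1 \<Rightarrow> 'h) \<Rightarrow> 'h set \<Rightarrow> 'h set" where
  "generated_subalgebra scale X = \<Inter>{A. subalgebra scale A \<and> X \<subseteq> A}"

definition affine_algebra :: "('k::field \<Rightarrow> 'h::ring_1 \<Rightarrow> 'h) \<Rightarrow> 'h set \<Rightarrow> bool" where
  "affine_algebra scale A \<longleftrightarrow> (\<exists>G. finite G \<and> A = generated_subalgebra scale G)"

section \<open>Subcoalgebras and the Hopf coradical\<close>

text \<open>
  The elements of \<open>D \<otimes> D \<subseteq> H \<otimes> H\<close> are those given by a formal sum of tensors with both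
  entries in \<open>D\<close>.
\<close>

definition subcoalgebra ::
    "('k::field \<Rightarrow> 'h::ab_group_add \<Rightarrow> 'h) \<Rightarrow> ('h \<Rightarrow> (('h \<times> 'h) \<Rightarrow>\<^sub>0 'k) set) \<Rightarrow> 'h set \<Rightarrow> bool" where
  "subcoalgebra scale \<Delta> D \<longleftrightarrow>
    module.subspace scale D \<and> (\<forall>x\<in>D. \<exists>u\<in>\<Delta> x. Poly_Mapping.keys u \<subseteq> D \<times> D)"

definition simple_subcoalgebra ::
    "('k::field \<Rightarrow> 'h::ab_group_add \<Rightarrow> 'h) \<Rightarrow> ('h \<Rightarrow> (('h \<times> 'h) \<Rightarrow>\<^sub>0 'k) set) \<Rightarrow> 'h set \<Rightarrow> bool" where
  "simple_subcoalgebra scale \<Delta> D \<longleftrightarrow>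
    subcoalgebra scale \<Delta> D \<and> D \<noteq> {0} \<and>
    (\<forall>E. subcoalgebra scale \<Delta> E \<and> E \<subseteq> D \<longrightarrow> E = {0} \<or> E = D)"

definition coradical ::
    "('k::field \<Rightarrow> 'h::ab_group_add \<Rightarrow> 'h) \<Rightarrow> ('h \<Rightarrow> (('h \<times> 'h) \<Rightarrow>\<^sub>0 'k) set) \<Rightarrow> 'h set" where
  "coradical scale \<Delta> = module.span scale (\<Union>{D. simple_subcoalgebra scale \<Delta> D})"

definition hopf_coradical ::
    "('k::field \<Rightarrow> 'h::ring_1 \<Rightarrow> 'h) \<Rightarrow> ('h \<Rightarrow> (('h \<times> 'h) \<Rightarrow>\<^sub>0 'k) set) \<Rightarrow> 'h set" where
  "hopf_coradical scale \<Delta> = generated_subalgebra scale (coradical scale \<Delta>)"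

definition hopf_subalgebra ::
    "('k::field \<Rightarrow> 'h::ring_1 \<Rightarrow> 'h) \<Rightarrow> ('h \<Rightarrow> (('h \<times> 'h) \<Rightarrow>\<^sub>0 'k) set) \<Rightarrow> ('h \<Rightarrow> 'h) \<Rightarrow>
      'h set \<Rightarrow> bool" where
  "hopf_subalgebra scale \<Delta> S A \<longleftrightarrow>
    subalgebra scale A \<and> subcoalgebra scale \<Delta> A \<and> S ` A \<subseteq> A"

end

theory Submission
  imports Defs
begin

text \<open>
  Write \<open>lhit f x = \<Sum> f(x\<^sub>1) x\<^sub>2\<close> and \<open>rhit f x = \<Sum> f(x\<^sub>2) x\<^sub>1\<close>; subcoalgebras are the subspaces stable
  under all these operators. By finiteness, \<open>H\<close> is generated by a finite-dimensional subcoalgebra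
  \<open>C\<close> containing \<open>1\<close>, so every simple subcoalgebra \<open>D\<close> lies in a power \<open>C\<^sup>n\<close>. If
  \<open>D \<subseteq> U C W\<close> for subcoalgebras \<open>U, W\<close>, choose \<open>X \<subseteq> C\<close> of least dimension
  with \<open>D \<subseteq> U X W\<close>. As \<open>D\<close> is simple, it lies in one of two subcoalgebras as soon as it lies in their
  wedge, so \<open>X\<close> is not contained in a wedge of two proper subcoalgebras; dually to
  finite-dimensional prime algebras being simple, \<open>X\<close> is then simple. Replacing the factors one
  at a time, \<open>D\<close> lies in the subalgebra generated by the simple subcoalgebras of \<open>C\<close>, whose span is
  finite-dimensional.
\<close>

section \<open>Linear functionals\<close>

lemma vector_space_mult: "vector_space ((*) :: 'k::field \<Rightarrow> 'k \<Rightarrow> 'k)"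
  by unfold_locales (auto simp: algebra_simps)

text \<open>
  \<open>vector_space\<close> is interpreted for real vector spaces without a mandatory qualifier, so constants
  defined in it would be shadowed by their real instances; hence a separate locale.
\<close>

locale lin_space = vector_space scale
  for scale :: "'k::field \<Rightarrow> 'v::ab_group_add \<Rightarrow> 'v"

locale lin_space_pair = vs1: lin_space s1 + vs2: lin_space s2
  for s1 :: "'k::field \<Rightarrow> 'v::ab_group_add \<Rightarrow> 'v" and s2 :: "'k::field \<Rightarrow> 'w::ab_group_add \<Rightarrow> 'w"
begin

sublocale vector_space_pair s1 s2 ..

end

context lin_space
begin

definition functional :: "('v \<Rightarrow> 'k) \<Rightarrow> bool" where
  "functional f \<longleftrightarrow> Vector_Spaces.linear scale (*) f"

lemma functional_iff:
  "functional f \<longleftrightarrow> (\<forall>x y. f (x + y) = f x + f y) \<and> (\<forall>c x. f (scale c x) = c * f x)"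
  by (simp add: functional_def Vector_Spaces.linear_iff vector_space_mult vector_space_axioms)

lemma functional_add: "functional f \<Longrightarrow> f (x + y) = f x + f y"
  and functional_scale: "functional f \<Longrightarrow> f (scale c x) = c * f x"
  by (simp_all add: functional_iff)

lemma functional_zero: "functional f \<Longrightarrow> f 0 = 0"
  using functional_scale[of f 0 0] by simp

lemma linear_selfI:
  "(\<And>x y. f (x + y) = f x + f y) \<Longrightarrow> (\<And>c x. f (scale c x) = scale c (f x))
    \<Longrightarrow> Vector_Spaces.linear scale scale f"
  by (simp add: Vector_Spaces.linear_iff vector_space_axioms)

lemma functional_compose:
  assumes "functional f" "Vector_Spaces.linear scale scale p"
  shows "functional (\<lambda>x. f (p x))"
  using assms by (simp add: functional_iff Vector_Spaces.linear_iff)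

lemma functional_plus: "functional f \<Longrightarrow> functional g \<Longrightarrow> functional (\<lambda>x. f x + g x)"
  and functional_minus: "functional f \<Longrightarrow> functional g \<Longrightarrow> functional (\<lambda>x. f x - g x)"
  and functional_times: "functional f \<Longrightarrow> functional (\<lambda>x. c * f x)"
  and functional_0: "functional (\<lambda>x. 0)"
  by (simp_all add: functional_iff algebra_simps)

lemma functional_sum:
  "(\<And>i. i \<in> I \<Longrightarrow> functional (f i)) \<Longrightarrow> functional (\<lambda>x. \<Sum>i\<in>I. f i x)"
  by (induction I rule: infinite_finite_induct) (auto intro: functional_plus functional_0)

text \<open>Extend a basis \<open>B\<close> of \<open>W\<close> to a basis \<open>C\<close> of the
  whole space and let \<open>p\<close> kill \<open>B\<close> and fix the other basis vectors: the
  projection along \<open>W\<close> onto a complement.\<close>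

lemma complement_projection:
  assumes W: "subspace W"
  obtains p where "Vector_Spaces.linear scale scale p" "\<And>x. x - p x \<in> W" "\<And>w. w \<in> W \<Longrightarrow> p w = 0"
proof -
  interpret pr: vector_space_pair scale scale by unfold_locales
  obtain B where B: "B \<subseteq> W" "independent B" "W \<subseteq> span B"
    using maximal_independent_subset by blast
  obtain C where C: "B \<subseteq> C" "independent C" "UNIV \<subseteq> span C"
    using maximal_independent_subset_extend[of B UNIV] B by auto
  obtain p where p: "Vector_Spaces.linear scale scale p"
      "\<forall>x\<in>C. p x = (if x \<in> B then 0 else x)"
    using pr.linear_independent_extend[OF C(2), of "\<lambda>x. if x \<in> B then 0 else x"] by blast
  interpret p: Vector_Spaces.linear scale scale p by fact
  have 1: "x - p x \<in> W" for x
  proof -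
    have "x \<in> span C" using C by auto
    then show ?thesis
    proof (induction rule: span_induct)
      case base
      show ?case
        by (rule subspaceI)
          (use W in \<open>auto simp: p.add p.scale subspace_0 scale_right_diff_distrib[symmetric]
             subspace_scale add_diff_add subspace_add\<close>)
    next
      case (step x)
      then show ?case using p B W by (auto simp: subspace_0)
    qed
  qed
  have 2: "p w = 0" if "w \<in> W" for w
    by (rule p.eq_0_on_span[of B]) (use that B C p in auto)
  show ?thesis by (rule that[OF p(1) 1 2])
qed

lemma functional_nonzero:
  assumes "y \<noteq> 0"
  obtains f where "functional f" "f y = 1"
proof -
  interpret pr: vector_space_pair scale "(*) :: 'k \<Rightarrow> 'k \<Rightarrow> 'k"
    by (intro vector_space_pair.intro vector_space_axioms vector_space_mult)
  have "\<not> dependent {y}" using assms by simp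
  from pr.linear_independent_extend[OF this, of "\<lambda>_. 1"] show ?thesis
    using that unfolding functional_def by auto
qed

lemma functional_separating:
  assumes "subspace W" "x \<notin> W"
  obtains f where "functional f" "\<And>w. w \<in> W \<Longrightarrow> f w = 0" "f x = 1"
proof -
  obtain p where p: "Vector_Spaces.linear scale scale p" "\<And>x. x - p x \<in> W" "\<And>w. w \<in> W \<Longrightarrow> p w = 0"
    using complement_projection[OF assms(1)] by blast
  have "p x \<noteq> 0" using p(2)[of x] assms(2) by auto
  then obtain f where f: "functional f" "f (p x) = 1" using functional_nonzero by blast
  show ?thesis
    by (rule that[of "\<lambda>x. f (p x)"]) (use f p in \<open>auto simp: functional_compose functional_zero\<close>)
qed

lemma functional_eqI: "(\<And>f. functional f \<Longrightarrow> f x = f y) \<Longrightarrow> x = y"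
  using functional_nonzero[of "x - y"] functional_add[of _ "x - y" y]
  by (metis add_cancel_left_left diff_add_cancel eq_iff_diff_eq_0 zero_neq_one)

text \<open>The projection \<open>p\<close> along \<open>W\<close> is injective on \<open>V\<close>
  because \<open>V\<close> meets \<open>W\<close> only in zero. So it has a left inverse
  \<open>g\<close> on \<open>V\<close>, and \<open>e\<close> after \<open>g\<close> after
  \<open>p\<close> is the required functional.\<close>

lemma functional_extension:
  assumes V: "subspace V" and W: "subspace W" and VW: "V \<inter> W \<subseteq> {0}" and e: "functional e"
  obtains f where "functional f" "\<And>v. v \<in> V \<Longrightarrow> f v = e v" "\<And>w. w \<in> W \<Longrightarrow> f w = 0"
proof -
  interpret pr: vector_space_pair scale scale by unfold_locales
  obtain p where p: "Vector_Spaces.linear scale scale p" "\<And>x. x - p x \<in> W" "\<And>w. w \<in> W \<Longrightarrow> p w = 0"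
    using complement_projection[OF W] by blast
  interpret p: Vector_Spaces.linear scale scale p by fact
  have "inj_on p V"
  proof (rule inj_onI)
    fix x y assume xy: "x \<in> V" "y \<in> V" "p x = p y"
    then have "p (x - y) = 0" by (simp add: p.diff)
    then have "x - y \<in> W" using p(2)[of "x - y"] by simp
    moreover have "x - y \<in> V" using xy V by (simp add: subspace_diff)
    ultimately show "x = y" using VW by auto
  qed
  from pr.linear_exists_left_inverse_on[OF p(1) V this]
  obtain g where g: "Vector_Spaces.linear scale scale g" "\<forall>v\<in>V. g (p v) = v" by blast
  interpret g: Vector_Spaces.linear scale scale g by fact
  show ?thesis
    by (rule that[of "\<lambda>x. e (g (p x))"])
      (use g p e in \<open>auto simp: functional_iff functional_zero p.add g.add p.scale g.scale\<close>)
qed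

text \<open>A basis of \<open>V\<close> extends to one of the span of \<open>W\<close>, properly
  since otherwise \<open>W\<close> would lie in \<open>V\<close>. The finite bound \<open>B\<close>
  matters: \<open>dim\<close> is a \<open>card\<close>, hence 0 for an infinite basis.\<close>

lemma dim_psubset_finite:
  assumes "subspace V" "V \<subset> W" "W \<subseteq> span B" "finite B"
  shows "dim V < dim W"
proof -
  obtain C where C: "C \<subseteq> V" "independent C" "V \<subseteq> span C" "card C = dim V"
    using basis_exists by blast
  obtain E where E: "C \<subseteq> E" "E \<subseteq> W" "independent E" "W \<subseteq> span E"
    using maximal_independent_subset_extend[of C W] C assms(2) by blast
  have "finite E" using independent_span_bound[OF assms(4) E(3)] E(2) assms(3) by auto
  moreover have "C \<noteq> E"
    using E(4) C(1) assms(1,2) span_minimal[of C V] by blast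
  ultimately have "card C < card E" using E(1) by (intro psubset_card_mono) auto
  then show ?thesis using C(4) basis_card_eq_dim[OF E(2,4,3)] by simp
qed

end

section \<open>Evaluation of formal sums\<close>

definition bilin :: "('k::field \<Rightarrow> 'v::ab_group_add \<Rightarrow> 'v) \<Rightarrow> ('k \<Rightarrow> 'w::ab_group_add \<Rightarrow> 'w) \<Rightarrow>
    ('v \<Rightarrow> 'v \<Rightarrow> 'w) \<Rightarrow> bool" where
  "bilin s t F \<longleftrightarrow>
    (\<forall>x x' y. F (x + x') y = F x y + F x' y) \<and> (\<forall>x y y'. F x (y + y') = F x y + F x y') \<and>
    (\<forall>c x y. F (s c x) y = t c (F x y)) \<and> (\<forall>c x y. F x (s c y) = t c (F x y))"

definition trilin :: "('k::field \<Rightarrow> 'v::ab_group_add \<Rightarrow> 'v) \<Rightarrow> ('k \<Rightarrow> 'w::ab_group_add \<Rightarrow> 'w) \<Rightarrow>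
    ('v \<Rightarrow> 'v \<Rightarrow> 'v \<Rightarrow> 'w) \<Rightarrow> bool" where
  "trilin s t F \<longleftrightarrow>
    (\<forall>x. bilin s t (F x)) \<and>
    (\<forall>x x' y z. F (x + x') y z = F x y z + F x' y z) \<and> (\<forall>c x y z. F (s c x) y z = t c (F x y z))"

lemma lin_ext_cong:
  "(\<And>x. x \<in> Poly_Mapping.keys u \<Longrightarrow> F x = G x) \<Longrightarrow> lin_ext s F u = lin_ext s G u"
  by (simp add: lin_ext_def)

context lin_space
begin

lemma lin_ext_superset:
  assumes "finite A" "Poly_Mapping.keys u \<subseteq> A"
  shows "lin_ext scale F u = (\<Sum>x\<in>A. scale (Poly_Mapping.lookup u x) (F x))"
  unfolding lin_ext_def using assms by (intro sum.mono_neutral_left) (auto simp: in_keys_iff)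

lemma lin_ext_add: "lin_ext scale F (u + v) = lin_ext scale F u + lin_ext scale F v"
proof -
  let ?A = "Poly_Mapping.keys u \<union> Poly_Mapping.keys v"
  have "Poly_Mapping.keys (u + v) \<subseteq> ?A" by (rule keys_add)
  then show ?thesis
    by (simp add: lin_ext_superset[of ?A] lookup_add scale_left_distrib sum.distrib)
qed

lemma lin_ext_fscale: "lin_ext scale F (fscale c u) = scale c (lin_ext scale F u)"
proof -
  have "Poly_Mapping.keys (fscale c u) \<subseteq> Poly_Mapping.keys u"
    by (auto simp: in_keys_iff lookup_fscale)
  then show ?thesis
    by (simp add: lin_ext_superset[of "Poly_Mapping.keys u"] lookup_fscale scale_sum_right)
qed

lemma linear_lin_ext: "Vector_Spaces.linear fscale scale (lin_ext scale F)"
  by (simp add: Vector_Spaces.linear_iff vector_space_axioms vector_space_fscale lin_ext_add lin_ext_fscale)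

lemma lin_ext_diff: "lin_ext scale F (u - v) = lin_ext scale F u - lin_ext scale F v"
  using lin_ext_add[of F "u - v" v] by simp

lemma lin_ext_gen: "lin_ext scale F (gen x) = F x"
  by (simp add: lin_ext_def gen_def)

lemma lin_ext_in_subspace:
  "subspace V \<Longrightarrow> (\<And>x. x \<in> Poly_Mapping.keys u \<Longrightarrow> F x \<in> V) \<Longrightarrow> lin_ext scale F u \<in> V"
  unfolding lin_ext_def by (intro subspace_sum subspace_scale) auto

end

context lin_space_pair
begin

lemma linear_lin_ext_compose:
  assumes "Vector_Spaces.linear s1 s2 T"
  shows "T (lin_ext s1 F u) = lin_ext s2 (\<lambda>x. T (F x)) u"
proof -
  interpret T: Vector_Spaces.linear s1 s2 T by fact
  show ?thesis by (simp add: lin_ext_def T.sum T.scale)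
qed

end

context lin_space
begin

lemma lin_ext_lin_ext:
  "lin_ext scale F (lin_ext fscale G u) = lin_ext scale (\<lambda>x. lin_ext scale F (G x)) u"
  by (rule lin_space_pair.linear_lin_ext_compose[OF lin_space_pair.intro linear_lin_ext])
    (intro lin_space.intro vector_space_fscale vector_space_axioms)+

end

lemma gen_eq_lin_ext: "lin_ext fscale gen u = u"
proof (rule poly_mapping_eqI)
  fix x
  have "Poly_Mapping.lookup (\<Sum>y\<in>A. fscale (Poly_Mapping.lookup u y) (gen y)) x
      = (\<Sum>y\<in>A. if y = x then Poly_Mapping.lookup u y else 0)" if "finite A" for A
    using that by (induction A) (auto simp: lookup_add lookup_fscale gen_def lookup_single when_def)
  then show "Poly_Mapping.lookup (lin_ext fscale gen u) x = Poly_Mapping.lookup u x"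
    by (simp add: lin_ext_def in_keys_iff)
qed

lemma keys_lin_ext_fscale:
  fixes F :: "'x \<Rightarrow> 'y \<Rightarrow>\<^sub>0 'k::field"
  shows "Poly_Mapping.keys (lin_ext fscale F u) \<subseteq> (\<Union>x\<in>Poly_Mapping.keys u. Poly_Mapping.keys (F x))"
proof -
  have "Poly_Mapping.keys (\<Sum>y\<in>A. fscale (c y) (F y)) \<subseteq> (\<Union>x\<in>A. Poly_Mapping.keys (F x))"
    if "finite A" for A and c :: "'x \<Rightarrow> 'k"
    using that
  proof (induction A)
    case (insert y A)
    have "Poly_Mapping.keys (fscale (c y) (F y)) \<subseteq> Poly_Mapping.keys (F y)"
      by (auto simp: in_keys_iff lookup_fscale)
    then show ?case using insert keys_add by fastforce
  qed simp
  then show ?thesis by (simp add: lin_ext_def)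
qed

lemma keys_gen: "Poly_Mapping.keys (gen x :: 'x \<Rightarrow>\<^sub>0 'k::field) = {x}"
  by (simp add: gen_def)

section \<open>Multilinear maps and the tensor relations\<close>

context lin_space_pair
begin

text \<open>A bilinear map kills the generators of the relations, hence is well defined on the
  tensor square.\<close>

lemma lin_ext_tensor2_rel:
  assumes w: "w \<in> tensor2_rel s1" and F: "bilin s1 s2 F"
  shows "lin_ext s2 (\<lambda>(a, b). F a b) w = 0"
proof -
  interpret f: vector_space "fscale :: 'k \<Rightarrow> ('v \<times> 'v \<Rightarrow>\<^sub>0 'k) \<Rightarrow> _" by (rule vector_space_fscale)
  interpret l: Vector_Spaces.linear fscale s2 "lin_ext s2 (\<lambda>(a, b). F a b)"
    by (rule vs2.linear_lin_ext)
  show ?thesis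
    by (rule l.eq_0_on_span[OF _ w[unfolded tensor2_rel_def]])
      (use F in \<open>auto simp: l.diff l.scale vs2.lin_ext_gen bilin_def\<close>)
qed

lemma lin_ext_tensor3_rel:
  assumes w: "w \<in> tensor3_rel s1" and F: "trilin s1 s2 F"
  shows "lin_ext s2 (\<lambda>(a, b, c). F a b c) w = 0"
proof -
  interpret f: vector_space "fscale :: 'k \<Rightarrow> ('v \<times> 'v \<times> 'v \<Rightarrow>\<^sub>0 'k) \<Rightarrow> _" by (rule vector_space_fscale)
  interpret l: Vector_Spaces.linear fscale s2 "lin_ext s2 (\<lambda>(a, b, c). F a b c)"
    by (rule vs2.linear_lin_ext)
  show ?thesis
    by (rule l.eq_0_on_span[OF _ w[unfolded tensor3_rel_def]])
      (use F in \<open>auto simp: l.diff l.scale vs2.lin_ext_gen bilin_def trilin_def\<close>)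
qed

end

context lin_space
begin

lemma subspace_tensor2_rel: "module.subspace fscale (tensor2_rel scale)"
  unfolding tensor2_rel_def
  by (rule module.subspace_span)
    (use vector_space_fscale module_iff_vector_space in blast)

text \<open>Injectivity of the map from V \<otimes> V to Hom(V*, V) given by contracting the first
  leg. If \<open>w\<close> were not a relation, some functional \<open>\<phi>\<close> would vanish
  on all relations but not at \<open>w\<close>, and \<open>\<phi>\<close> amounts to a bilinear form
  \<open>F\<close>. Expanding first entries in a basis writes \<open>\<phi> w\<close> as a sum of
  values \<open>F b z\<close>, where \<open>z\<close> is the contraction of \<open>w\<close> with
  the coordinate functional of \<open>b\<close>, which is zero by assumption.\<close>

lemma tensor2_relI:
  assumes w: "\<And>f. functional f \<Longrightarrow> lin_ext scale (\<lambda>(a, b). scale (f a) b) w = 0"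
  shows "w \<in> tensor2_rel scale"
proof (rule ccontr)
  interpret f: lin_space "fscale :: 'k \<Rightarrow> ('v \<times> 'v \<Rightarrow>\<^sub>0 'k) \<Rightarrow> _" by (intro lin_space.intro vector_space_fscale)
  interpret m: lin_space "(*) :: 'k \<Rightarrow> 'k \<Rightarrow> 'k" by (intro lin_space.intro vector_space_mult)
  interpret sm: lin_space_pair scale "(*)" by unfold_locales
  interpret fm: lin_space_pair "fscale :: 'k \<Rightarrow> ('v \<times> 'v \<Rightarrow>\<^sub>0 'k) \<Rightarrow> _" "(*)" by unfold_locales
  let ?R = "tensor2_rel scale"
  assume "w \<notin> ?R"
  then obtain \<phi> where phi: "f.functional \<phi>" "\<And>r. r \<in> ?R \<Longrightarrow> \<phi> r = 0" "\<phi> w = 1"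
    using f.functional_separating[OF subspace_tensor2_rel] by blast
  interpret phi: Vector_Spaces.linear "fscale :: 'k \<Rightarrow> ('v \<times> 'v \<Rightarrow>\<^sub>0 'k) \<Rightarrow> _" "(*)" \<phi>
    using phi(1) by (simp add: f.functional_def)
  define F where "F a b = \<phi> (gen (a, b))" for a b
  have base: "r \<in> ?R" if "r \<in> {gen (x + x', y) - gen (x, y) - gen (x', y) | x x' y. True} \<union>
     {gen (x, y + y') - gen (x, y) - gen (x, y') | x y y'. True} \<union>
     {gen (scale c x, y) - fscale c (gen (x, y)) | c x y. True} \<union>
     {gen (x, scale c y) - fscale c (gen (x, y)) | c x y. True}" for r
    unfolding tensor2_rel_def by (rule f.span_base[OF that])
  have "\<phi> (gen (x + x', y) - gen (x, y) - gen (x', y)) = 0"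
       "\<phi> (gen (x, y + y') - gen (x, y) - gen (x, y')) = 0"
       "\<phi> (gen (scale c x, y) - fscale c (gen (x, y))) = 0"
       "\<phi> (gen (x, scale c y) - fscale c (gen (x, y))) = 0" for x x' y y' c
    by (rule phi(2), rule base, blast)+
  then have F: "F (x + x') y = F x y + F x' y" "F x (y + y') = F x y + F x y'"
     "F (scale c x) y = c * F x y" "F x (scale c y) = c * F x y" for x x' y y' c
    by (simp_all add: F_def phi.diff phi.scale phi.add algebra_simps)
  obtain B where B: "independent B" "UNIV \<subseteq> span B"
    using maximal_independent_subset[of UNIV] by blast
  \<comment> \<open>\<open>r b\<close> is the coordinate functional of the basis vector
    \<open>b\<close>.\<close>
  define r where "r b a = representation B a b" for a b
  have r: "functional (r b)" for b
    using B unfolding functional_iff r_def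
    by (auto simp: representation_add representation_scale top.extremum_unique)
  let ?K = "Poly_Mapping.keys w"
  \<comment> \<open>Only finitely many basis vectors occur in the first entries of \<open>w\<close>,
    so the expansion and the exchange of sums below are finite.\<close>
  define K where "K = (\<Union>(a, _)\<in>?K. {b. r b a \<noteq> 0})"
  have finK: "finite K"
    unfolding K_def r_def by (auto intro!: finite_representation)
  have expand: "F a c = (\<Sum>b\<in>K. r b a * F b c)" if ac: "(a, c) \<in> ?K" for a c
  proof -
    have "a = (\<Sum>b\<in>{b. r b a \<noteq> 0}. scale (r b a) b)"
      unfolding r_def by (rule sum_nonzero_representation_eq[symmetric]) (use B in auto)
    also have "\<dots> = (\<Sum>b\<in>K. scale (r b a) b)"
      by (rule sum.mono_neutral_left) (use finK ac in \<open>auto simp: K_def\<close>)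
    finally have "F a c = F (\<Sum>b\<in>K. scale (r b a) b) c" by simp
    also have "\<dots> = (\<Sum>b\<in>K. r b a * F b c)"
    proof -
      interpret Fc: Vector_Spaces.linear scale "(*)" "\<lambda>x. F x c"
        by (simp add: F Vector_Spaces.linear_iff vector_space_axioms vector_space_mult)
      show ?thesis by (simp add: Fc.sum F(3))
    qed
    finally show ?thesis .
  qed
  have "\<phi> w = \<phi> (lin_ext fscale gen w)" by (simp add: gen_eq_lin_ext)
  also have "\<dots> = lin_ext (*) (\<lambda>x. \<phi> (gen x)) w"
    by (rule fm.linear_lin_ext_compose) (rule phi.linear_axioms)
  also have "\<dots> = (\<Sum>(a, c)\<in>?K. Poly_Mapping.lookup w (a, c) * F a c)"
    by (simp add: lin_ext_def F_def case_prod_unfold)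
  also have "\<dots> = (\<Sum>(a, c)\<in>?K. \<Sum>b\<in>K. Poly_Mapping.lookup w (a, c) * (r b a * F b c))"
    by (intro sum.cong refl) (auto simp: expand sum_distrib_left)
  also have "\<dots> = (\<Sum>b\<in>K. \<Sum>(a, c)\<in>?K. Poly_Mapping.lookup w (a, c) * (r b a * F b c))"
    unfolding case_prod_unfold by (rule sum.swap)
  also have "\<dots> = (\<Sum>b\<in>K. F b (lin_ext scale (\<lambda>(a, c). scale (r b a) c) w))"
  proof (rule sum.cong[OF refl])
    fix b
    have "Vector_Spaces.linear scale (*) (F b)"
      by (simp add: F Vector_Spaces.linear_iff vector_space_axioms vector_space_mult)
    from sm.linear_lin_ext_compose[OF this, of "\<lambda>(a, c). scale (r b a) c" w]
    show "(\<Sum>(a, c)\<in>?K. Poly_Mapping.lookup w (a, c) * (r b a * F b c)) =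
          F b (lin_ext scale (\<lambda>(a, c). scale (r b a) c) w)"
      by (simp add: lin_ext_def case_prod_unfold F)
  qed
  also have "\<dots> = 0"
  proof -
    have "F b 0 = 0" for b using F(4)[of b 0 0] by simp
    then show ?thesis by (simp add: w[OF r])
  qed
  finally show False using phi(3) by simp
qed

end

section \<open>The hit actions\<close>

context coalgebra
begin

sublocale lin_space scale ..

lemma scalar_pair: "lin_space_pair scale (*)"
  by (intro lin_space_pair.intro lin_space.intro vector_space_axioms vector_space_mult)

lemma self_pair: "lin_space_pair scale scale"
  by (intro lin_space_pair.intro lin_space.intro vector_space_axioms)

text \<open>An arbitrary expression for the comultiplication of \<open>x\<close>; by
  \<open>lin_ext_comult_unique\<close>, evaluating a bilinear map on it does not depend on the
  choice.\<close>

definition rep :: "'h \<Rightarrow> ('h \<times> 'h) \<Rightarrow>\<^sub>0 'k" where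
  "rep x = (SOME u. u \<in> \<Delta> x)"

lemma comult_iff: "u \<in> \<Delta> x \<Longrightarrow> v \<in> \<Delta> x \<longleftrightarrow> v - u \<in> tensor2_rel scale"
proof -
  interpret f: vector_space "fscale :: 'k \<Rightarrow> ('h \<times> 'h \<Rightarrow>\<^sub>0 'k) \<Rightarrow> _" by (rule vector_space_fscale)
  assume u: "u \<in> \<Delta> x"
  obtain w where w: "\<Delta> x = tensor2_class scale w" using comult_tensor by blast
  have uw: "u - w \<in> tensor2_rel scale" using u w by (simp add: tensor2_class_def)
  have "v - w \<in> tensor2_rel scale \<longleftrightarrow> v - u \<in> tensor2_rel scale"
    using f.subspace_diff[OF subspace_tensor2_rel _ uw, of "v - w"]
      f.subspace_add[OF subspace_tensor2_rel _ uw, of "v - u"] by auto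
  then show ?thesis by (simp add: w tensor2_class_def)
qed

lemma rep: "rep x \<in> \<Delta> x"
proof -
  interpret f: vector_space "fscale :: 'k \<Rightarrow> ('h \<times> 'h \<Rightarrow>\<^sub>0 'k) \<Rightarrow> _" by (rule vector_space_fscale)
  obtain w where w: "\<Delta> x = tensor2_class scale w" using comult_tensor by blast
  then have "w \<in> \<Delta> x" using f.subspace_0[OF subspace_tensor2_rel] by (simp add: tensor2_class_def)
  then show ?thesis unfolding rep_def by (rule someI)
qed

lemma lin_ext_comult_unique:
  assumes "lin_space_pair scale s" "bilin scale s F" "u \<in> \<Delta> x" "v \<in> \<Delta> x"
  shows "lin_ext s (\<lambda>(a, b). F a b) u = lin_ext s (\<lambda>(a, b). F a b) v"
proof -
  interpret pr: lin_space_pair scale s by fact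
  have "u - v \<in> tensor2_rel scale" using comult_iff assms(3,4) by blast
  from pr.lin_ext_tensor2_rel[OF this assms(2)] show ?thesis by (simp add: pr.vs2.lin_ext_diff)
qed

text \<open>In Sweedler notation, \<open>lhit f x = \<Sum> f(x\<^sub>1) x\<^sub>2\<close> and \<open>rhit f x = \<Sum> f(x\<^sub>2) x\<^sub>1\<close>.\<close>

definition lhit :: "('h \<Rightarrow> 'k) \<Rightarrow> 'h \<Rightarrow> 'h" where
  "lhit f x = lin_ext scale (\<lambda>(a, b). scale (f a) b) (rep x)"

definition rhit :: "('h \<Rightarrow> 'k) \<Rightarrow> 'h \<Rightarrow> 'h" where
  "rhit f x = lin_ext scale (\<lambda>(a, b). scale (f b) a) (rep x)"

lemma bilin_left: "functional f \<Longrightarrow> bilin scale scale (\<lambda>a b. scale (f a) b)"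
  and bilin_right: "functional f \<Longrightarrow> bilin scale scale (\<lambda>a b. scale (f b) a)"
  by (simp_all add: bilin_def functional_add functional_scale algebra_simps)

lemma lhit_eq: "functional f \<Longrightarrow> u \<in> \<Delta> x \<Longrightarrow> lhit f x = lin_ext scale (\<lambda>(a, b). scale (f a) b) u"
  unfolding lhit_def by (rule lin_ext_comult_unique[OF self_pair bilin_left rep])

lemma rhit_eq: "functional f \<Longrightarrow> u \<in> \<Delta> x \<Longrightarrow> rhit f x = lin_ext scale (\<lambda>(a, b). scale (f b) a) u"
  unfolding rhit_def by (rule lin_ext_comult_unique[OF self_pair bilin_right rep])

lemma lhit_add: "functional f \<Longrightarrow> lhit f (x + y) = lhit f x + lhit f y"
  and rhit_add: "functional f \<Longrightarrow> rhit f (x + y) = rhit f x + rhit f y"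
  using lhit_eq[OF _ comult_add[OF rep rep]] rhit_eq[OF _ comult_add[OF rep rep]]
  by (simp_all add: lin_ext_add lhit_def rhit_def)

lemma lhit_scale: "functional f \<Longrightarrow> lhit f (scale c x) = scale c (lhit f x)"
  and rhit_scale: "functional f \<Longrightarrow> rhit f (scale c x) = scale c (rhit f x)"
  using lhit_eq[OF _ comult_scale[OF rep]] rhit_eq[OF _ comult_scale[OF rep]]
  by (simp_all add: lin_ext_fscale lhit_def rhit_def)

lemma linear_lhit: "functional f \<Longrightarrow> Vector_Spaces.linear scale scale (lhit f)"
  and linear_rhit: "functional f \<Longrightarrow> Vector_Spaces.linear scale scale (rhit f)"
  by (auto intro!: linear_selfI simp: lhit_add lhit_scale rhit_add rhit_scale)

lemma lhit_zero: "functional f \<Longrightarrow> lhit f 0 = 0"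
  using lhit_scale[of f 0 0] by simp

lemma functional_lhit: "functional f \<Longrightarrow> functional g \<Longrightarrow> functional (\<lambda>x. f (lhit g x))"
  by (simp add: functional_compose linear_lhit)

lemma lhit_plus: "lhit (\<lambda>x. f x + g x) x = lhit f x + lhit g x"
  and lhit_minus: "lhit (\<lambda>x. f x - g x) x = lhit f x - lhit g x"
  and lhit_times: "lhit (\<lambda>x. c * f x) x = scale c (lhit f x)"
  by (simp_all add: lhit_def lin_ext_def case_prod_unfold algebra_simps sum.distrib
      sum_subtractf scale_sum_right)

lemma lhit_sum: "lhit (\<lambda>x. \<Sum>i\<in>I. f i x) x = (\<Sum>i\<in>I. lhit (f i) x)"
proof (induction I rule: infinite_finite_induct)
  case (insert i I)
  then show ?case by (simp add: lhit_plus)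
qed (simp_all add: lhit_def lin_ext_def case_prod_unfold)

lemma functional_counit: "functional \<epsilon>"
  using counit_linear by (simp add: functional_def)

lemma lhit_counit [simp]: "lhit \<epsilon> x = x"
  and rhit_counit [simp]: "rhit \<epsilon> x = x"
  by (simp_all add: lhit_def rhit_def counit_left rep counit_right)

section \<open>Transposition and composition laws of the hit actions\<close>

lemma functional_lin_ext:
  "functional f \<Longrightarrow> f (lin_ext scale F u) = lin_ext (*) (\<lambda>x. f (F x)) u"
  unfolding functional_def by (rule lin_space_pair.linear_lin_ext_compose[OF scalar_pair])

lemma linear_lin_ext_self:
  "Vector_Spaces.linear scale scale T \<Longrightarrow> T (lin_ext scale F u) = lin_ext scale (\<lambda>x. T (F x)) u"
  by (rule lin_space_pair.linear_lin_ext_compose[OF self_pair])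

text \<open>Both sides are \<open>\<Sum> f(x\<^sub>1) g(x\<^sub>2)\<close>. This transposition
  converts statements about \<open>lhit\<close> into statements about \<open>rhit\<close>.\<close>

lemma functional_lhit_rhit:
  assumes "functional f" "functional g"
  shows "g (lhit f x) = f (rhit g x)"
  using assms unfolding lhit_def rhit_def
  by (simp add: functional_lin_ext case_prod_unfold functional_scale mult.commute)

text \<open>Coassociativity holds modulo \<open>tensor3_rel\<close>, so it becomes an equation in
  the space itself once a trilinear map is applied.\<close>

lemma coassoc_trilin:
  assumes F: "trilin scale scale F"
  shows "lin_ext scale (\<lambda>(a, b). lin_ext scale (\<lambda>(a1, a2). F a1 a2 b) (rep a)) (rep x)
       = lin_ext scale (\<lambda>(a, b). lin_ext scale (\<lambda>(b1, b2). F a b1 b2) (rep b)) (rep x)"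
proof -
  have "lin_ext scale (\<lambda>(a, b, c). F a b c)
    (lin_ext fscale (\<lambda>(a, b). lin_ext fscale (\<lambda>(a1, a2). gen (a1, a2, b)) (rep a)) (rep x)
      - lin_ext fscale (\<lambda>(a, b). lin_ext fscale (\<lambda>(b1, b2). gen (a, b1, b2)) (rep b)) (rep x)) = 0"
    by (rule lin_space_pair.lin_ext_tensor3_rel[OF self_pair coassoc[OF rep] F]) (rule rep)
  then show ?thesis
    by (simp add: lin_ext_diff lin_ext_lin_ext lin_ext_gen case_prod_unfold)
qed

lemma lin_ext_scale_right:
  "lin_ext scale (\<lambda>x. scale (f x) b) u = scale (lin_ext (*) f u) b"
  by (simp add: lin_ext_def scale_sum_left)

lemma lin_ext_scale_left:
  "lin_ext scale (\<lambda>x. scale c (F x)) u = scale c (lin_ext scale F u)"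
  "lin_ext scale (\<lambda>x. scale (c * d x) (F x)) u = scale c (lin_ext scale (\<lambda>x. scale (d x) (F x)) u)"
  by (simp_all add: lin_ext_def scale_sum_right ac_simps)

text \<open>The functional on the right is the convolution product of \<open>g\<close> and
  \<open>f\<close>; both sides are \<open>\<Sum> g(x\<^sub>1) f(x\<^sub>2) x\<^sub>3\<close>. So the
  dual algebra acts by \<open>lhit\<close>.\<close>

lemma lhit_lhit:
  assumes f: "functional f" and g: "functional g"
  shows "lhit f (lhit g x) = lhit (\<lambda>y. f (lhit g y)) x"
proof -
  have "trilin scale scale (\<lambda>a b c. scale (g a * f b) c)"
    using f g by (simp add: trilin_def bilin_def functional_add functional_scale algebra_simps)
  from coassoc_trilin[OF this, of x]
  have "lin_ext scale (\<lambda>(a, b). scale (f (lhit g a)) b) (rep x)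
      = lin_ext scale (\<lambda>(a, b). scale (g a) (lhit f b)) (rep x)"
    using f g
    by (simp add: lhit_def case_prod_unfold functional_lin_ext functional_scale
        lin_ext_scale_right[symmetric] lin_ext_scale_left[symmetric])
  then show ?thesis
    using f by (simp add: lhit_def[of g x] lhit_def[of "\<lambda>y. f (lhit g y)" x]
        linear_lin_ext_self linear_lhit case_prod_unfold lhit_scale)
qed

text \<open>Both sides are \<open>\<Sum> f(x\<^sub>1) g(x\<^sub>3) x\<^sub>2\<close>.\<close>

lemma lhit_rhit:
  assumes f: "functional f" and g: "functional g"
  shows "lhit f (rhit g x) = rhit g (lhit f x)"
proof -
  have "trilin scale scale (\<lambda>a b c. scale (f a) (scale (g c) b))"
    using f g by (simp add: trilin_def bilin_def functional_add functional_scale algebra_simps)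
  from coassoc_trilin[OF this, of x]
  have "lin_ext scale (\<lambda>(a, b). lhit f (scale (g b) a)) (rep x)
      = lin_ext scale (\<lambda>(a, b). rhit g (scale (f a) b)) (rep x)"
    using f g
    by (simp add: lhit_scale rhit_scale)
      (simp add: lhit_def rhit_def case_prod_unfold lin_ext_scale_left[symmetric] mult.commute)
  then show ?thesis
    using f g by (simp add: lhit_def[of f x] rhit_def[of g x]
        linear_lin_ext_self linear_lhit linear_rhit case_prod_unfold)
qed

text \<open>Both sides are \<open>\<Sum> h(x\<^sub>2) p(x\<^sub>3) x\<^sub>1\<close>; the functional
  is the convolution of \<open>h\<close> and \<open>p\<close>.\<close>

lemma rhit_rhit:
  assumes h: "functional h" and p: "functional p"
  shows "rhit h (rhit p x) = rhit (\<lambda>y. p (lhit h y)) x"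
proof -
  have "trilin scale scale (\<lambda>a b c. scale (p c * h b) a)"
    using h p by (simp add: trilin_def bilin_def functional_add functional_scale algebra_simps)
  from coassoc_trilin[OF this, of x]
  have "lin_ext scale (\<lambda>(a, b). scale (p b) (rhit h a)) (rep x)
      = lin_ext scale (\<lambda>(a, b). scale (p (lhit h b)) a) (rep x)"
    using h p
    by (simp add: lhit_def rhit_def case_prod_unfold functional_lin_ext functional_scale
        lin_ext_scale_right[symmetric] lin_ext_scale_left[symmetric] mult.commute)
  then show ?thesis
    using h p by (simp add: rhit_def[of p x] rhit_def[of "\<lambda>y. p (lhit h y)" x]
        linear_lin_ext_self linear_rhit case_prod_unfold rhit_scale)
qed

section \<open>Subcoalgebras as stable subspaces\<close>

text \<open>With a projection \<open>p\<close> onto \<open>A\<close>, applying \<open>p\<close> to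
  both legs of an expression for \<Delta>(x) yields entries in \<open>A\<close>. By
  \<open>tensor2_relI\<close> the result still represents \<Delta>(x) if every contraction of the
  first leg is unchanged.\<close>

lemma keys_closed_subspace:
  assumes A: "subspace A" "x \<in> A"
    and p: "\<And>f. functional f \<Longrightarrow> lhit f x \<in> A \<and> rhit f x \<in> A"
  shows "\<exists>u\<in>\<Delta> x. Poly_Mapping.keys u \<subseteq> A \<times> A"
proof -
  obtain q where q: "Vector_Spaces.linear scale scale q" "\<And>x. x - q x \<in> A" "\<And>w. w \<in> A \<Longrightarrow> q w = 0"
    using complement_projection[OF A(1)] by blast
  interpret q: Vector_Spaces.linear scale scale q by fact
  \<comment> \<open>\<open>q\<close> kills \<open>A\<close> and \<open>x - q x\<close> lies in
    \<open>A\<close>, so the complementary \<open>p\<close> is a projection onto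
    \<open>A\<close>.\<close>
  define p where "p x = x - q x" for x
  have lp: "Vector_Spaces.linear scale scale p"
    by (rule linear_selfI) (auto simp: p_def q.add q.scale algebra_simps)
  have pA: "p x \<in> A" and pid: "x \<in> A \<Longrightarrow> p x = x" for x
    using q(2,3) by (auto simp: p_def)
  define v where "v = lin_ext fscale (\<lambda>(a, b). gen (p a, p b)) (rep x)"
  have "v - rep x \<in> tensor2_rel scale"
  proof (rule tensor2_relI)
    fix f assume f: "functional f"
    have fp: "functional (\<lambda>x. f (p x))" using f lp by (rule functional_compose)
    have "lin_ext scale (\<lambda>(a, b). scale (f a) b) v
        = lin_ext scale (\<lambda>(a, b). p (scale (f (p a)) b)) (rep x)"
      using lp by (simp add: v_def lin_ext_lin_ext case_prod_unfold lin_ext_gen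
          linear_iff_module_hom module_hom.scale)
    also have "\<dots> = p (lhit (\<lambda>x. f (p x)) x)"
      by (simp add: lhit_def linear_lin_ext_self[OF lp] case_prod_unfold)
    also have "\<dots> = lhit (\<lambda>x. f (p x)) x" using p[OF fp] pid by blast
    \<comment> \<open>Tested against \<open>g\<close>, the inner \<open>p\<close> acts on
      \<open>rhit g x\<close> by transposition, and that element already lies in
      \<open>A\<close>.\<close>
    also have "\<dots> = lhit f x"
    proof (rule functional_eqI)
      fix g assume g: "functional g"
      have "g (lhit (\<lambda>x. f (p x)) x) = f (p (rhit g x))"
        by (rule functional_lhit_rhit[OF fp g])
      also have "\<dots> = g (lhit f x)"
        using p[OF g] pid functional_lhit_rhit[OF f g] by simp
      finally show "g (lhit (\<lambda>x. f (p x)) x) = g (lhit f x)" .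
    qed
    finally show "lin_ext scale (\<lambda>(a, b). scale (f a) b) (v - rep x) = 0"
      by (simp add: lin_ext_diff lhit_def)
  qed
  then have "v \<in> \<Delta> x" using comult_iff[OF rep] by blast
  moreover have "Poly_Mapping.keys v \<subseteq> A \<times> A"
    using keys_lin_ext_fscale[of "\<lambda>(a, b). gen (p a, p b)" "rep x"] pA
    by (auto simp: v_def keys_gen split: prod.splits)
  ultimately show ?thesis by blast
qed

lemma subcoalgebra_iff_stable:
  "subcoalgebra scale \<Delta> D \<longleftrightarrow>
    subspace D \<and> (\<forall>x\<in>D. \<forall>f. functional f \<longrightarrow> lhit f x \<in> D \<and> rhit f x \<in> D)"
  (is "?l \<longleftrightarrow> ?r")
proof
  assume l: ?l
  then have D: "subspace D" by (simp add: subcoalgebra_def)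
  show ?r
  proof (intro conjI D ballI allI impI)
    fix x f assume x: "x \<in> D" and f: "functional f"
    obtain u where u: "u \<in> \<Delta> x" "Poly_Mapping.keys u \<subseteq> D \<times> D"
      using l x by (auto simp: subcoalgebra_def)
    show "lhit f x \<in> D"
      unfolding lhit_eq[OF f u(1)] by (rule lin_ext_in_subspace[OF D]) (use u D in \<open>auto intro: subspace_scale\<close>)
    show "rhit f x \<in> D"
      unfolding rhit_eq[OF f u(1)] by (rule lin_ext_in_subspace[OF D]) (use u D in \<open>auto intro: subspace_scale\<close>)
  qed
next
  assume ?r
  then show ?l unfolding subcoalgebra_def by (auto intro: keys_closed_subspace)
qed

lemma subcoalgebraI:
  "subspace D \<Longrightarrow> (\<And>x f. x \<in> D \<Longrightarrow> functional f \<Longrightarrow> lhit f x \<in> D) \<Longrightarrow>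
    (\<And>x f. x \<in> D \<Longrightarrow> functional f \<Longrightarrow> rhit f x \<in> D) \<Longrightarrow> subcoalgebra scale \<Delta> D"
  by (simp add: subcoalgebra_iff_stable)

lemma subcoalgebra_subspace: "subcoalgebra scale \<Delta> D \<Longrightarrow> subspace D"
  and subcoalgebra_lhit: "subcoalgebra scale \<Delta> D \<Longrightarrow> functional f \<Longrightarrow> x \<in> D \<Longrightarrow> lhit f x \<in> D"
  and subcoalgebra_rhit: "subcoalgebra scale \<Delta> D \<Longrightarrow> functional f \<Longrightarrow> x \<in> D \<Longrightarrow> rhit f x \<in> D"
  by (simp_all add: subcoalgebra_iff_stable)

lemma subcoalgebra_Int:
  "subcoalgebra scale \<Delta> D \<Longrightarrow> subcoalgebra scale \<Delta> E \<Longrightarrow> subcoalgebra scale \<Delta> (D \<inter> E)"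
  by (simp add: subcoalgebra_iff_stable subspace_inter)

text \<open>\<open>D \<inter> E\<close> is a nonzero subcoalgebra of \<open>D\<close>, so simplicity
  makes it all of \<open>D\<close>.\<close>

lemma simple_subcoalgebra_subset:
  assumes "simple_subcoalgebra scale \<Delta> D" "subcoalgebra scale \<Delta> E" "x \<in> D" "x \<in> E" "x \<noteq> 0"
  shows "D \<subseteq> E"
  using assms subcoalgebra_Int[of D E] unfolding simple_subcoalgebra_def by blast

section \<open>Finite-dimensional subcoalgebras\<close>

lemma subspace_lhit_preimage:
  assumes "subspace M" "functional f"
  shows "subspace {x. lhit f x \<in> M}"
proof -
  interpret l: Vector_Spaces.linear scale scale "lhit f" using assms(2) by (rule linear_lhit)
  show ?thesis by (rule l.subspace_linear_preimage) (rule assms(1))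
qed

lemma subspace_rhit_preimage:
  assumes "subspace M" "functional f"
  shows "subspace {x. rhit f x \<in> M}"
proof -
  interpret l: Vector_Spaces.linear scale scale "rhit f" using assms(2) by (rule linear_rhit)
  show ?thesis by (rule l.subspace_linear_preimage) (rule assms(1))
qed

text \<open>Fundamental theorem of coalgebras. \<open>M\<close> consists of the contractions
  \<open>\<Sum> f(x\<^sub>1) h(x\<^sub>3) x\<^sub>2\<close> of iterated comultiplications; the
  composition laws make its span stable, and \<open>f = h = \<epsilon>\<close> recovers
  \<open>x\<close>.\<close>

lemma finite_subcoalgebra_containing:
  assumes "finite G"
  obtains C B where "subcoalgebra scale \<Delta> C" "G \<subseteq> C" "finite B" "C \<subseteq> span B"
proof -
  define M where "M = {lhit f (rhit h x) | f h x. functional f \<and> functional h \<and> x \<in> G}"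
  \<comment> \<open>The middle legs that occur when \<open>rep\<close> is applied to
    \<open>x\<close> and then to each first leg; there are finitely many, and they span
    \<open>M\<close>.\<close>
  define B where "B = (\<Union>x\<in>G. \<Union>y\<in>fst ` Poly_Mapping.keys (rep x). snd ` Poly_Mapping.keys (rep y))"
  have M: "lhit f (rhit h x) \<in> M" if "functional f" "functional h" "x \<in> G" for f h x
    using that unfolding M_def by blast
  have 1: "subcoalgebra scale \<Delta> (span M)"
  proof (rule subcoalgebraI)
    fix x f assume x: "x \<in> span M" and f: "functional f"
    have "lhit f m \<in> span M \<and> rhit f m \<in> span M" if "m \<in> M" for m
    proof -
      from that obtain g h y where m: "m = lhit g (rhit h y)" "functional g" "functional h" "y \<in> G"
        unfolding M_def by blast
      have "lhit f m = lhit (\<lambda>y. f (lhit g y)) (rhit h y)"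
        and "rhit f m = lhit g (rhit (\<lambda>y. h (lhit f y)) y)"
        using f m by (simp_all add: lhit_lhit lhit_rhit[symmetric] rhit_rhit)
      then show ?thesis
        using f m by (auto intro!: span_base M functional_lhit)
    qed
    then have "M \<subseteq> {x. lhit f x \<in> span M}" "M \<subseteq> {x. rhit f x \<in> span M}"
      by blast+
    from span_minimal[OF this(1) subspace_lhit_preimage] span_minimal[OF this(2) subspace_rhit_preimage]
    show "lhit f x \<in> span M" "rhit f x \<in> span M" using x f by auto
  qed simp
  have 2: "G \<subseteq> span M"
    using M[OF functional_counit functional_counit] by (auto intro: span_base)
  have 3: "span M \<subseteq> span B"
  proof (rule span_minimal)
    show "M \<subseteq> span B"
    proof
      fix z assume "z \<in> M"
      then obtain f h x where z: "z = lhit f (rhit h x)" "functional f" "functional h" "x \<in> G"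
        unfolding M_def by blast
      have "z = lin_ext scale (\<lambda>(a, b). scale (h b) (lhit f a)) (rep x)"
        using z by (simp add: rhit_def linear_lin_ext_self linear_lhit case_prod_unfold lhit_scale)
      also have "\<dots> \<in> span B"
      proof (rule lin_ext_in_subspace)
        fix k assume k: "k \<in> Poly_Mapping.keys (rep x)"
        have "lhit f (fst k) \<in> span B"
          unfolding lhit_def
        proof (rule lin_ext_in_subspace)
          fix l assume "l \<in> Poly_Mapping.keys (rep (fst k))"
          then have "snd l \<in> B" using k z(4) unfolding B_def by blast
          then show "(case l of (a, b) \<Rightarrow> scale (f a) b) \<in> span B"
            by (auto simp: case_prod_unfold intro: span_scale span_base)
        qed simp
        then show "(case k of (a, b) \<Rightarrow> scale (h b) (lhit f a)) \<in> span B"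
          by (auto simp: case_prod_unfold intro: span_scale)
      qed simp
      finally show "z \<in> span B" .
    qed
  qed simp
  have "finite B" unfolding B_def using assms by auto
  then show ?thesis using that 1 2 3 by blast
qed

end

section \<open>Prime coalgebras are simple\<close>

context coalgebra
begin

text \<open>These are the left coideals, that is, the submodules for the action of the dual algebra
  by \<open>lhit\<close>.\<close>

definition left_stable :: "'h set \<Rightarrow> bool" where
  "left_stable M \<longleftrightarrow> subspace M \<and> (\<forall>x\<in>M. \<forall>f. functional f \<longrightarrow> lhit f x \<in> M)"

lemma left_stable_subspace: "left_stable M \<Longrightarrow> subspace M"
  and left_stable_lhit: "left_stable M \<Longrightarrow> functional f \<Longrightarrow> x \<in> M \<Longrightarrow> lhit f x \<in> M"
  by (simp_all add: left_stable_def)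

text \<open>Take a proper left stable subspace of greatest dimension: \<open>{0}\<close> shows that
  one exists, and \<open>dim X\<close> bounds the dimensions.\<close>

lemma maximal_left_stable:
  assumes "subspace X" "X \<subseteq> span B" "finite B" "X \<noteq> {0}"
  obtains N where "left_stable N" "N \<subset> X"
    "\<And>M. left_stable M \<Longrightarrow> N \<subseteq> M \<Longrightarrow> M \<subseteq> X \<Longrightarrow> M = N \<or> M = X"
proof -
  let ?P = "\<lambda>N. left_stable N \<and> N \<subset> X"
  have "?P {0}" using assms(1,4) subspace_0 by (auto simp: left_stable_def lhit_zero)
  moreover have "\<forall>N. ?P N \<longrightarrow> dim N < dim X"
    using dim_psubset_finite assms(2,3) by (auto simp: left_stable_def)
  ultimately obtain N where N: "?P N" and max: "\<forall>M. ?P M \<longrightarrow> dim M \<le> dim N"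
    using ex_has_greatest_nat[of ?P "{0}" dim "dim X"] by blast
  show ?thesis
  proof (rule that)
    show "left_stable N" "N \<subset> X" using N by auto
    fix M assume M: "left_stable M" "N \<subseteq> M" "M \<subseteq> X"
    show "M = N \<or> M = X"
    proof (rule ccontr)
      assume "\<not> (M = N \<or> M = X)"
      then have "?P M" "N \<subset> M" using M by auto
      moreover have "dim N < dim M"
        using dim_psubset_finite[of N M B] \<open>N \<subset> M\<close> N M(3) assms(2,3) left_stable_subspace by blast
      ultimately show False using max by (meson linorder_not_less)
    qed
  qed
qed

text \<open>The hypothesis \<open>prime\<close> forbids \<open>X\<close> to lie in a wedge of two
  proper subcoalgebras: its premise on \<open>X1\<close>, \<open>X2\<close> says that \<Delta>(X)
  lies in X2 \<otimes> H + H \<otimes> X1. For a maximal left coideal \<open>N\<close> in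
  \<open>X\<close>, the quotient X / N is a simple faithful module over the dual algebra of
  \<open>X\<close>. The annihilator of a nonzero proper subcoalgebra \<open>Y\<close> would be a
  nonzero ideal; it is shown to contain the counit of \<open>X\<close>, which forces
  \<open>Y\<close> to be zero.\<close>

lemma prime_imp_simple_subcoalgebra:
  assumes X: "subcoalgebra scale \<Delta> X" and fin: "X \<subseteq> span B" "finite B" and X0: "X \<noteq> {0}"
    and prime: "\<And>X1 X2. subcoalgebra scale \<Delta> X1 \<Longrightarrow> subcoalgebra scale \<Delta> X2 \<Longrightarrow> X1 \<subseteq> X \<Longrightarrow> X2 \<subseteq> X \<Longrightarrow>
      (\<And>f x. functional f \<Longrightarrow> (\<And>y. y \<in> X2 \<Longrightarrow> f y = 0) \<Longrightarrow> x \<in> X \<Longrightarrow> lhit f x \<in> X1) \<Longrightarrow>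
      X1 = X \<or> X2 = X"
  shows "simple_subcoalgebra scale \<Delta> X"
proof -
  note X' = subcoalgebra_subspace[OF X] subcoalgebra_lhit[OF X] subcoalgebra_rhit[OF X]
  obtain N where N: "left_stable N" "N \<subset> X"
    and max: "\<And>M. left_stable M \<Longrightarrow> N \<subseteq> M \<Longrightarrow> M \<subseteq> X \<Longrightarrow> M = N \<or> M = X"
    using maximal_left_stable[OF X'(1) fin X0] by blast
  note N' = left_stable_subspace[OF N(1)] left_stable_lhit[OF N(1)]
  \<comment> \<open>Primeness makes the simple module \<open>X / N\<close> faithful.\<close>
  have faithful: "f y = 0" if f: "functional f" "\<And>x. x \<in> X \<Longrightarrow> lhit f x \<in> N" and y: "y \<in> X" for f y
  proof -
    \<comment> \<open>The largest subcoalgebra of \<open>X\<close> inside \<open>N\<close>.\<close>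
    define X1 where "X1 = {x \<in> X. \<forall>g. functional g \<longrightarrow> rhit g x \<in> N}"
    \<comment> \<open>The matrix coefficients of X / N. By transposition, a functional kills
      \<open>M\<close> exactly when \<open>lhit\<close> by it sends \<open>X\<close> into
      \<open>N\<close>.\<close>
    define M where "M = {rhit p x | p x. functional p \<and> (\<forall>n\<in>N. p n = 0) \<and> x \<in> X}"
    have X1: "subcoalgebra scale \<Delta> X1"
    proof (rule subcoalgebraI)
      have "X1 = X \<inter> \<Inter>((\<lambda>g. {x. rhit g x \<in> N}) ` {g. functional g})"
        by (auto simp: X1_def)
      then show "subspace X1"
        using X'(1) N'(1) by (auto intro!: subspace_inter subspace_Inter subspace_rhit_preimage)
    next
      fix x f assume "x \<in> X1" "functional f"
      then show "lhit f x \<in> X1" "rhit f x \<in> X1"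
        using X' N'(2) by (auto simp: X1_def lhit_rhit[symmetric] rhit_rhit functional_lhit)
    qed
    have M: "rhit p x \<in> M" if "functional p" "\<And>n. n \<in> N \<Longrightarrow> p n = 0" "x \<in> X" for p x
      using that unfolding M_def by blast
    have X2: "subcoalgebra scale \<Delta> (span M)"
    proof (rule subcoalgebraI)
      fix x f assume x: "x \<in> span M" and f: "functional f"
      have "lhit f m \<in> span M \<and> rhit f m \<in> span M" if "m \<in> M" for m
      proof -
        from that obtain p z where m: "m = rhit p z" "functional p" "\<And>n. n \<in> N \<Longrightarrow> p n = 0" "z \<in> X"
          unfolding M_def by blast
        have "lhit f m = rhit p (lhit f z)" "rhit f m = rhit (\<lambda>y. p (lhit f y)) z"
          using m f by (simp_all add: lhit_rhit rhit_rhit)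
        moreover have "rhit p (lhit f z) \<in> M" using m f X' by (intro M) auto
        moreover have "rhit (\<lambda>y. p (lhit f y)) z \<in> M"
          using m f N' by (intro M functional_lhit) auto
        ultimately show ?thesis by (simp add: span_base)
      qed
      then have "M \<subseteq> {x. lhit f x \<in> span M}" "M \<subseteq> {x. rhit f x \<in> span M}"
        by blast+
      from span_minimal[OF this(1) subspace_lhit_preimage] span_minimal[OF this(2) subspace_rhit_preimage]
      show "lhit f x \<in> span M" "rhit f x \<in> span M" using x f by auto
    qed simp
    \<comment> \<open>A functional killing \<open>M\<close> sends \<open>X\<close> into
      \<open>N\<close>, and even into \<open>X1\<close> because \<open>lhit\<close> and
      \<open>rhit\<close> commute. So \<open>prime\<close> applies; as \<open>X1\<close> is inside
      the proper subspace \<open>N\<close>, the coefficients fill \<open>X\<close>.\<close>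
    have "X1 = X \<or> span M = X"
    proof (rule prime[OF X1 X2])
      show "X1 \<subseteq> X" by (auto simp: X1_def)
      show "span M \<subseteq> X" by (rule span_minimal) (auto simp: M_def X')
      fix f x assume f: "functional f" "\<And>y. y \<in> span M \<Longrightarrow> f y = 0" and x: "x \<in> X"
      have "lhit f z \<in> N" if z: "z \<in> X" for z
      proof (rule ccontr)
        assume "lhit f z \<notin> N"
        then obtain p where p: "functional p" "\<And>n. n \<in> N \<Longrightarrow> p n = 0" "p (lhit f z) = 1"
          using functional_separating[OF N'(1)] by blast
        have "f (rhit p z) = 0" by (intro f span_base M p z)
        then show False using p functional_lhit_rhit[OF f(1) p(1), of z] by simp
      qed
      then show "lhit f x \<in> X1"
        using f x X' by (auto simp: X1_def lhit_rhit[symmetric])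
    qed
    moreover have "X1 \<noteq> X"
    proof
      assume "X1 = X"
      then have "rhit \<epsilon> x \<in> N" if "x \<in> X" for x
        using that functional_counit rhit_counit[of x] unfolding X1_def by (metis (mono_tags, lifting) mem_Collect_eq)
      then show False using N(2) by auto
    qed
    ultimately have XM: "span M = X" by simp
    interpret f: Vector_Spaces.linear scale "(*)" f using f(1) by (simp add: functional_def)
    have "f m = 0" if "m \<in> M" for m
    proof -
      from that obtain p z where m: "m = rhit p z" "functional p" "\<And>n. n \<in> N \<Longrightarrow> p n = 0" "z \<in> X"
        unfolding M_def by blast
      then show ?thesis using f(2)[OF m(4)] functional_lhit_rhit[OF f(1) m(2), of z] by simp
    qed
    then show ?thesis using f.eq_0_on_span y XM by blast
  qed
  show ?thesis
    unfolding simple_subcoalgebra_def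
  proof (intro conjI X X0 allI impI)
    fix Y assume "subcoalgebra scale \<Delta> Y \<and> Y \<subseteq> X"
    then have Y: "subcoalgebra scale \<Delta> Y" and YX: "Y \<subseteq> X" by auto
    note Y' = subcoalgebra_subspace[OF Y] subcoalgebra_lhit[OF Y]
    show "Y = {0} \<or> Y = X"
    proof (rule ccontr)
      assume "\<not> (Y = {0} \<or> Y = X)"
      then have Yn0: "Y \<noteq> {0}" and "Y \<noteq> X" by auto
      then obtain x0 where x0: "x0 \<in> X" "x0 \<notin> Y" using YX by blast
      obtain k where k: "functional k" "\<And>y. y \<in> Y \<Longrightarrow> k y = 0" "k x0 = 1"
        using functional_separating[OF Y'(1) x0(2)] by blast
      \<comment> \<open>The annihilator of \<open>Y\<close>, a two-sided ideal of the dual algebra: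
        one side uses stability of \<open>Y\<close> under \<open>rhit\<close>, the other under
        \<open>lhit\<close>.\<close>
      define I where "I = {f. functional f \<and> (\<forall>y\<in>Y. f y = 0)}"
      have I_left: "(\<lambda>x. g (lhit f x)) \<in> I" if "f \<in> I" "functional g" for f g
      proof -
        have "g (lhit f y) = 0" if y: "y \<in> Y" for y
          using functional_lhit_rhit[of f g y] subcoalgebra_rhit[OF Y \<open>functional g\<close> y] \<open>f \<in> I\<close>
            \<open>functional g\<close> by (simp add: I_def)
        then show ?thesis using that by (auto simp: I_def functional_lhit)
      qed
      have I_right: "(\<lambda>x. f (lhit g x)) \<in> I" if "f \<in> I" "functional g" for f g
        using that Y' by (auto simp: I_def functional_lhit)
      \<comment> \<open>Finite sets whose classes in X / N have joint annihilator zero on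
        \<open>X\<close>. A basis of \<open>X\<close> is one, by faithfulness, and \<open>E\<close>
        is chosen with fewest elements.\<close>
      let ?faith = "\<lambda>E. finite E \<and> E \<subseteq> X \<and>
        (\<forall>f. functional f \<and> (\<forall>b\<in>E. lhit f b \<in> N) \<longrightarrow> (\<forall>x\<in>X. f x = 0))"
      obtain C where C: "C \<subseteq> X" "independent C" "X \<subseteq> span C"
        using maximal_independent_subset by blast
      have "finite C" using independent_span_bound[OF fin(2) C(2)] C(1) fin(1) by auto
      moreover have "f x = 0" if "functional f" "\<forall>b\<in>C. lhit f b \<in> N" "x \<in> X" for f x
      proof -
        have "span C \<subseteq> {x. lhit f x \<in> N}"
          by (rule span_minimal) (use that N'(1) in \<open>auto intro: subspace_lhit_preimage\<close>)
        then show ?thesis using faithful[OF that(1) _ that(3)] C(3) by blast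
      qed
      ultimately have "?faith C" using C(1) by blast
      then obtain E where E: "?faith E" and min: "\<And>E'. ?faith E' \<Longrightarrow> card E \<le> card E'"
        using ex_has_least_nat[of ?faith C card] by blast
      define K where "K b = {f. functional f \<and> (\<forall>b'\<in>E - {b}. lhit f b' \<in> N)}" for b
      have K_left: "(\<lambda>x. g (lhit f x)) \<in> K b" if "f \<in> K b" "functional g" for f g b
      proof -
        have "lhit (\<lambda>x. g (lhit f x)) b' = lhit g (lhit f b')" for b'
          using that by (simp add: K_def lhit_lhit)
        then show ?thesis using that N' by (simp add: K_def functional_lhit)
      qed
      \<comment> \<open>Minimality of \<open>E\<close> replaces the density theorem: some \<open>f\<close> in the ideal \<open>I\<close> fixes
        \<open>b\<close> modulo \<open>N\<close> and kills \<open>E - {b}\<close>; the sum over \<open>b\<close> acts as the unit.\<close>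
      have proj: "\<exists>f\<in>I \<inter> K b. lhit f b - b \<in> N" if b: "b \<in> E" for b
      proof -
        have bX: "b \<in> X" using b E by auto
        have "\<not> ?faith (E - {b})"
          using min[of "E - {b}"] E b by (metis card_Diff1_less linorder_not_less)
        \<comment> \<open>Dropping \<open>b\<close> from the minimal \<open>E\<close> leaves a
          nonzero annihilator; such an \<open>e\<close> cannot send \<open>b\<close> into
          \<open>N\<close> as well.\<close>
        then obtain e where e: "e \<in> K b" "\<not> (\<forall>x\<in>X. e x = 0)"
          using E unfolding K_def by blast
        have eN: "lhit e b \<notin> N"
        proof
          assume "lhit e b \<in> N"
          then have "\<forall>b'\<in>E. lhit e b' \<in> N" using e(1) by (auto simp: K_def)
          then show False using E e by (auto simp: K_def)
        qed
        \<comment> \<open>The submodule of \<open>X\<close> generated by \<open>N\<close> and the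
          images of \<open>b\<close> under \<open>I \<inter> K b\<close>; maximality of
          \<open>N\<close> leaves only \<open>N\<close> and \<open>X\<close>.\<close>
        define P where "P = {lhit f b + n | f n. f \<in> I \<inter> K b \<and> n \<in> N}"
        have PI: "lhit f b + n \<in> P" if "f \<in> I \<inter> K b" "n \<in> N" for f n
          using that unfolding P_def by blast
        have fn: "functional f" if "f \<in> I \<inter> K b" for f using that by (auto simp: I_def)
        have add: "(\<lambda>x. f x + g x) \<in> I \<inter> K b" if "f \<in> I \<inter> K b" "g \<in> I \<inter> K b" for f g
          using that N'(1) by (auto simp: I_def K_def functional_plus lhit_plus subspace_add)
        have times: "(\<lambda>x. c * f x) \<in> I \<inter> K b" if "f \<in> I \<inter> K b" for c f
          using that N'(1) by (auto simp: I_def K_def functional_times lhit_times subspace_scale)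
        have zero: "(\<lambda>x. 0) \<in> I \<inter> K b"
          using times[of "\<lambda>x. 0" 0] functional_0 N'(1) lhit_times[of 0 "\<lambda>x. 0"]
          by (auto simp: I_def K_def subspace_0)
        have lhit0: "lhit (\<lambda>x. 0) x = 0" for x using lhit_times[of 0 "\<lambda>x. 0" x] by simp
        have NP: "N \<subseteq> P" using PI[OF zero] by (auto simp: lhit0)
        have "left_stable P"
          unfolding left_stable_def
        proof (intro conjI ballI allI impI)
          show "subspace P"
          proof (rule subspaceI)
            show "0 \<in> P" using NP N'(1) subspace_0 by blast
          next
            fix x y assume "x \<in> P" "y \<in> P"
            then obtain f n g m where "x = lhit f b + n" "y = lhit g b + m"
              "f \<in> I \<inter> K b" "g \<in> I \<inter> K b" "n \<in> N" "m \<in> N" unfolding P_def by blast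
            then show "x + y \<in> P"
              using PI[OF add subspace_add[OF N'(1)], of f g n m] by (simp add: lhit_plus algebra_simps)
          next
            fix c x assume "x \<in> P"
            then obtain f n where "x = lhit f b + n" "f \<in> I \<inter> K b" "n \<in> N"
              unfolding P_def by blast
            then show "scale c x \<in> P"
              using PI[OF times subspace_scale[OF N'(1)], of f n c c]
              by (simp add: lhit_times algebra_simps)
          qed
        next
          fix x g assume "x \<in> P" and g: "functional g"
          then obtain f n where x: "x = lhit f b + n" "f \<in> I \<inter> K b" "n \<in> N"
            unfolding P_def by blast
          then have "(\<lambda>x. g (lhit f x)) \<in> I \<inter> K b" using g I_left K_left by blast
          from PI[OF this N'(2)[OF g x(3)]] show "lhit g x \<in> P"
            using x g fn by (simp add: lhit_add lhit_lhit)
        qed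
        moreover have "P \<subseteq> X"
        proof
          fix x assume "x \<in> P"
          then obtain f n where "x = lhit f b + n" "f \<in> I \<inter> K b" "n \<in> N" unfolding P_def by blast
          then show "x \<in> X" using N(2) X'(2)[OF fn bX] subspace_add[OF X'(1)] by blast
        qed
        ultimately consider "P = N" | "P = X" using max NP by blast
        then show ?thesis
        proof cases
          case 1
          \<comment> \<open>The elements sent into \<open>N\<close> by \<open>I\<close> form a left
            stable subspace containing \<open>N\<close> and also \<open>lhit e b\<close>, so it is
            \<open>X\<close>. Then \<open>k\<close>, which lies in \<open>I\<close>, acts as zero on
            X / N, contradicting faithfulness and \<open>k x0 = 1\<close>.\<close>
          define Q where "Q = {x \<in> X. \<forall>f\<in>I. lhit f x \<in> N}"
          have "left_stable Q"
            unfolding left_stable_def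
          proof (intro conjI ballI allI impI)
            have "Q = X \<inter> \<Inter>((\<lambda>g. {x. lhit g x \<in> N}) ` I)"
              by (auto simp: Q_def)
            then show "subspace Q"
              using X'(1) N'(1)
              by (auto intro!: subspace_inter subspace_Inter subspace_lhit_preimage simp: I_def)
          next
            fix x g assume x: "x \<in> Q" and g: "functional g"
            then show "lhit g x \<in> Q"
              using I_right[OF _ g] X' by (auto simp: Q_def lhit_lhit I_def)
          qed
          moreover have "N \<subseteq> Q" using N(2) N'(2) by (auto simp: Q_def I_def)
          moreover have "Q \<subseteq> X" by (auto simp: Q_def)
          ultimately have "Q = N \<or> Q = X" using max by blast
          moreover have "lhit e b \<in> Q"
          proof -
            have e': "functional e" using e by (simp add: K_def)
            \<comment> \<open>Acting by \<open>e\<close> and then \<open>f\<close> amounts to one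
              functional in \<open>I \<inter> K b\<close>, so \<open>b\<close> is sent into
              \<open>P\<close>, which is \<open>N\<close> here.\<close>
            have "lhit f (lhit e b) \<in> N" if f: "f \<in> I" for f
            proof -
              have "functional f" using f by (simp add: I_def)
              then have "(\<lambda>x. f (lhit e x)) \<in> I \<inter> K b" using I_right[OF f e'] K_left[OF e(1)] by blast
              from PI[OF this subspace_0[OF N'(1)]] show ?thesis
                using 1 e' f by (simp add: lhit_lhit I_def)
            qed
            then show ?thesis using X'(2)[OF e' bX] by (simp add: Q_def)
          qed
          ultimately have "Q = X" using eN by blast
          moreover have "k \<in> I" using k by (simp add: I_def)
          ultimately have "lhit k x \<in> N" if "x \<in> X" for x using that by (auto simp: Q_def)
          from faithful[OF k(1) this x0(1)] k(3) show ?thesis by simp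
        next
          case 2
          then obtain f n where f: "b = lhit f b + n" "f \<in> I \<inter> K b" "n \<in> N"
            using bX unfolding P_def by blast
          from f(1) have "lhit f b - b = - n" by (metis add_diff_cancel_left' minus_diff_eq)
          then show ?thesis using f N'(1) subspace_neg by metis
        qed
      qed
      then obtain f where f: "\<And>b. b \<in> E \<Longrightarrow> f b \<in> I \<inter> K b" "\<And>b. b \<in> E \<Longrightarrow> lhit (f b) b - b \<in> N"
        by metis
      define s where "s x = (\<Sum>b\<in>E. f b x)" for x
      have s: "functional s" unfolding s_def using f by (intro functional_sum) (auto simp: I_def)
      \<comment> \<open>\<open>f b\<close> fixes \<open>b\<close> modulo \<open>N\<close> and the
        other summands send \<open>b\<close> into \<open>N\<close>. So \<open>s\<close> acts as the
        counit on \<open>E\<close> modulo \<open>N\<close>, and the choice of \<open>E\<close> makes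
        both agree on \<open>X\<close>.\<close>
      have "lhit (\<lambda>x. s x - \<epsilon> x) b \<in> N" if b: "b \<in> E" for b
      proof -
        have "lhit s b = (\<Sum>b'\<in>E. lhit (f b') b)"
          unfolding s_def by (rule lhit_sum)
        also have "\<dots> = lhit (f b) b + (\<Sum>b'\<in>E - {b}. lhit (f b') b)"
          using b E by (intro sum.remove) auto
        finally have "lhit (\<lambda>x. s x - \<epsilon> x) b = (lhit (f b) b - b) + (\<Sum>b'\<in>E - {b}. lhit (f b') b)"
          by (simp add: lhit_minus)
        also have "\<dots> \<in> N"
          using f b N'(1) by (intro subspace_add subspace_sum) (auto simp: K_def)
        finally show ?thesis .
      qed
      then have s\<epsilon>: "s x - \<epsilon> x = 0" if "x \<in> X" for x
        using that E functional_minus[OF s functional_counit] by auto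
      have eps0: "\<epsilon> y = 0" if "y \<in> Y" for y
      proof -
        have "s y = 0" unfolding s_def using f that by (intro sum.neutral) (auto simp: I_def)
        then show ?thesis using s\<epsilon>[of y] that YX by auto
      qed
      \<comment> \<open>Each \<open>h y\<close> is the value of \<open>\<epsilon>\<close> at
        \<open>lhit h y\<close>, an element of \<open>Y\<close>, where \<open>\<epsilon>\<close>
        vanishes.\<close>
      have "y = 0" if y: "y \<in> Y" for y
      proof (rule functional_eqI)
        fix h assume h: "functional h"
        have "h y = \<epsilon> (lhit h y)"
          using functional_lhit_rhit[OF h functional_counit, of y] by simp
        also have "\<dots> = 0" using eps0 Y'(2)[OF h y] by blast
        finally show "h y = h 0" using h by (simp add: functional_zero)
      qed
      then show False using Yn0 subspace_0[OF Y'(1)] by blast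
    qed
  qed
qed

end

section \<open>Products of subcoalgebras\<close>

lemma subalgebra_generated_subalgebra:
  assumes "vector_space scale"
  shows "subalgebra scale (generated_subalgebra scale X)"
proof -
  interpret vector_space scale by fact
  show ?thesis
    unfolding generated_subalgebra_def subalgebra_def
    by (intro conjI subspace_Inter) auto
qed

lemma generated_subalgebra_superset: "X \<subseteq> generated_subalgebra scale X"
  by (auto simp: generated_subalgebra_def)

lemma generated_subalgebra_minimal:
  "subalgebra scale A \<Longrightarrow> X \<subseteq> A \<Longrightarrow> generated_subalgebra scale X \<subseteq> A"
  by (auto simp: generated_subalgebra_def)

context bialgebra
begin

definition mprod :: "'h set \<Rightarrow> 'h set \<Rightarrow> 'h set" where
  "mprod U V = span {u * v | u v. u \<in> U \<and> v \<in> V}"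

lemma mprodI: "u \<in> U \<Longrightarrow> v \<in> V \<Longrightarrow> u * v \<in> mprod U V"
  unfolding mprod_def by (rule span_base) blast

lemma subspace_mprod [simp]: "subspace (mprod U V)"
  by (simp add: mprod_def)

lemma mprod_minimal:
  "subspace A \<Longrightarrow> (\<And>u v. u \<in> U \<Longrightarrow> v \<in> V \<Longrightarrow> u * v \<in> A) \<Longrightarrow> mprod U V \<subseteq> A"
  unfolding mprod_def by (rule span_minimal) blast+

lemma linear_mult_left: "Vector_Spaces.linear scale scale (\<lambda>x. a * x)"
  and linear_mult_right: "Vector_Spaces.linear scale scale (\<lambda>x. x * a)"
  by (auto intro!: linear_selfI simp: algebra_simps mult_scale_right scale_mult_left)

lemma subspace_mult_preimage:
  assumes "subspace A"
  shows "subspace {x. a * x \<in> A}" "subspace {x. x * a \<in> A}"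
  using assms
  by (auto intro!: subspaceI simp: subspace_0 subspace_add subspace_scale algebra_simps
      mult_scale_right scale_mult_left)

lemma mprod_assoc: "mprod U (mprod V W) = mprod (mprod U V) W"
proof
  show "mprod U (mprod V W) \<subseteq> mprod (mprod U V) W"
  proof (rule mprod_minimal)
    fix u v assume u: "u \<in> U" and "v \<in> mprod V W"
    moreover have "mprod V W \<subseteq> {v. u * v \<in> mprod (mprod U V) W}"
      by (rule mprod_minimal) (auto intro!: subspace_mult_preimage mprodI u simp: mult.assoc[symmetric])
    ultimately show "u * v \<in> mprod (mprod U V) W" by blast
  qed simp
  show "mprod (mprod U V) W \<subseteq> mprod U (mprod V W)"
  proof (rule mprod_minimal)
    fix u v assume "u \<in> mprod U V" and v: "v \<in> W"
    moreover have "mprod U V \<subseteq> {u. u * v \<in> mprod U (mprod V W)}"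
      by (rule mprod_minimal) (auto intro!: subspace_mult_preimage mprodI v simp: mult.assoc)
    ultimately show "u * v \<in> mprod U (mprod V W)" by blast
  qed simp
qed

text \<open>Lets the subcoalgebra condition for a span be checked on spanning elements only.\<close>

lemma subspace_comult_in:
  assumes "subspace A"
  shows "subspace {x. \<exists>u\<in>\<Delta> x. Poly_Mapping.keys u \<subseteq> A \<times> A}"
proof (rule subspaceI, goal_cases)
  case 1
  \<comment> \<open>Scaling any expression by 0 yields the empty formal sum as an expression for
    zero.\<close>
  have "fscale 0 (rep 0) \<in> \<Delta> (scale 0 0)" by (rule comult_scale[OF rep])
  moreover have "fscale 0 (rep 0) = 0" by (rule poly_mapping_eqI) (simp add: lookup_fscale)
  ultimately show ?case by (auto intro!: bexI[of _ 0])
next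
  case (2 x y)
  then obtain u v where "u \<in> \<Delta> x" "v \<in> \<Delta> y"
    "Poly_Mapping.keys u \<subseteq> A \<times> A" "Poly_Mapping.keys v \<subseteq> A \<times> A" by blast
  then show ?case using keys_add[of u v] comult_add[of u x v y] by blast
next
  case (3 c x)
  then obtain u where u: "u \<in> \<Delta> x" "Poly_Mapping.keys u \<subseteq> A \<times> A" by blast
  moreover have "Poly_Mapping.keys (fscale c u) \<subseteq> Poly_Mapping.keys u"
    by (auto simp: in_keys_iff lookup_fscale)
  ultimately show ?case using comult_scale[OF u(1), of c] by blast
qed

lemma keys_tensor2_mult:
  fixes u v :: "'h \<times> 'h \<Rightarrow>\<^sub>0 'k"
  shows "Poly_Mapping.keys (tensor2_mult u v) \<subseteq>
    {(a * c, b * d) | a b c d. (a, b) \<in> Poly_Mapping.keys u \<and> (c, d) \<in> Poly_Mapping.keys v}"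
proof
  fix k assume k: "k \<in> Poly_Mapping.keys (tensor2_mult u v)"
  define F where "F a b = (\<lambda>(c, d). gen (a * c, b * d) :: 'h \<times> 'h \<Rightarrow>\<^sub>0 'k)" for a b
  have "tensor2_mult u v = lin_ext fscale (\<lambda>(a, b). lin_ext fscale (F a b) v) u"
    by (simp add: tensor2_mult_def F_def)
  with k obtain a b where ab: "(a, b) \<in> Poly_Mapping.keys u"
      "k \<in> Poly_Mapping.keys (lin_ext fscale (F a b) v)"
    using keys_lin_ext_fscale[of "\<lambda>(a, b). lin_ext fscale (F a b) v" u] by auto
  then obtain c d where "(c, d) \<in> Poly_Mapping.keys v" "k \<in> Poly_Mapping.keys (F a b (c, d))"
    using keys_lin_ext_fscale[of "F a b" v] by auto
  then show "k \<in> {(a * c, b * d) | a b c d. (a, b) \<in> Poly_Mapping.keys u \<and> (c, d) \<in> Poly_Mapping.keys v}"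
    using ab(1) by (auto simp: F_def keys_gen)
qed

lemma subcoalgebra_mprod:
  assumes "subcoalgebra scale \<Delta> U" "subcoalgebra scale \<Delta> V"
  shows "subcoalgebra scale \<Delta> (mprod U V)"
proof -
  let ?A = "mprod U V"
  have "?A \<subseteq> {x. \<exists>u\<in>\<Delta> x. Poly_Mapping.keys u \<subseteq> ?A \<times> ?A}"
  proof (rule mprod_minimal[OF subspace_comult_in])
    fix x y assume "x \<in> U" "y \<in> V"
    then obtain u v where "u \<in> \<Delta> x" "v \<in> \<Delta> y"
      "Poly_Mapping.keys u \<subseteq> U \<times> U" "Poly_Mapping.keys v \<subseteq> V \<times> V"
      using assms unfolding subcoalgebra_def by blast
    then show "x * y \<in> {x. \<exists>u\<in>\<Delta> x. Poly_Mapping.keys u \<subseteq> ?A \<times> ?A}"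
      using comult_mult[of u x v y] keys_tensor2_mult[of u v]
      by (fastforce intro!: bexI[of _ "tensor2_mult u v"] mprodI)
  qed simp
  then show ?thesis by (auto simp: subcoalgebra_def)
qed

lemma subcoalgebra_span_one: "subcoalgebra scale \<Delta> (span {1})"
proof -
  have "span {1} \<subseteq> {x. \<exists>u\<in>\<Delta> x. Poly_Mapping.keys u \<subseteq> span {1} \<times> span {1}}"
    by (rule span_minimal)
      (auto intro!: subspace_comult_in bexI[OF _ comult_one] span_base simp: keys_gen)
  then show ?thesis by (auto simp: subcoalgebra_def)
qed

section \<open>The coradical and the subalgebras generated by subcoalgebras\<close>

lemma simple_subcoalgebra_in_coradical:
  assumes "simple_subcoalgebra scale \<Delta> D"
  shows "D \<subseteq> coradical scale \<Delta>"
  unfolding coradical_def by (rule order_trans[OF Union_upper span_superset]) (simp add: assms)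

lemma subcoalgebra_coradical: "subcoalgebra scale \<Delta> (coradical scale \<Delta>)"
proof -
  let ?A = "coradical scale \<Delta>"
  have "?A \<subseteq> {x. \<exists>u\<in>\<Delta> x. Poly_Mapping.keys u \<subseteq> ?A \<times> ?A}"
    unfolding coradical_def
  proof (rule span_minimal, fold coradical_def)
    show "\<Union>{D. simple_subcoalgebra scale \<Delta> D} \<subseteq> {x. \<exists>u\<in>\<Delta> x. Poly_Mapping.keys u \<subseteq> ?A \<times> ?A}"
    proof
      fix x assume "x \<in> \<Union>{D. simple_subcoalgebra scale \<Delta> D}"
      then obtain D where D: "simple_subcoalgebra scale \<Delta> D" "x \<in> D" by blast
      then obtain u where "u \<in> \<Delta> x" "Poly_Mapping.keys u \<subseteq> D \<times> D"
        unfolding simple_subcoalgebra_def subcoalgebra_def by blast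
      then show "x \<in> {x. \<exists>u\<in>\<Delta> x. Poly_Mapping.keys u \<subseteq> ?A \<times> ?A}" using simple_subcoalgebra_in_coradical[OF D(1)] by blast
    qed
    show "subspace {x. \<exists>u\<in>\<Delta> x. Poly_Mapping.keys u \<subseteq> ?A \<times> ?A}"
      by (rule subspace_comult_in) (simp add: coradical_def)
  qed
  then show ?thesis by (auto simp: subcoalgebra_def coradical_def)
qed

text \<open>Since comultiplication is an algebra map, the elements with an expression over
  \<open>?A\<close> form a subalgebra \<open>?T\<close>. It contains \<open>D\<close>, hence all of
  \<open>?A\<close>.\<close>

lemma subcoalgebra_generated_subalgebra:
  assumes "subcoalgebra scale \<Delta> D"
  shows "subcoalgebra scale \<Delta> (generated_subalgebra scale D)"
proof -
  let ?A = "generated_subalgebra scale D"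
  let ?T = "{x. \<exists>u\<in>\<Delta> x. Poly_Mapping.keys u \<subseteq> ?A \<times> ?A}"
  have A: "subspace ?A" "1 \<in> ?A" "\<And>x y. x \<in> ?A \<Longrightarrow> y \<in> ?A \<Longrightarrow> x * y \<in> ?A"
    using subalgebra_generated_subalgebra[OF vector_space_axioms, of D] by (auto simp: subalgebra_def)
  have "?A \<subseteq> ?T"
  proof (rule generated_subalgebra_minimal)
    show "D \<subseteq> ?T"
      using assms generated_subalgebra_superset[of D scale] unfolding subcoalgebra_def by blast
    show "subalgebra scale ?T"
      unfolding subalgebra_def
    proof (intro conjI ballI subspace_comult_in A(1))
      show "1 \<in> ?T" using A(2) by (auto intro!: bexI[OF _ comult_one] simp: keys_gen)
      fix x y assume "x \<in> ?T" "y \<in> ?T"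
      then obtain u v where "u \<in> \<Delta> x" "v \<in> \<Delta> y"
        "Poly_Mapping.keys u \<subseteq> ?A \<times> ?A" "Poly_Mapping.keys v \<subseteq> ?A \<times> ?A" by blast
      then show "x * y \<in> ?T"
        using comult_mult[of u x v y] keys_tensor2_mult[of u v] A(3)
        by (fastforce intro!: bexI[of _ "tensor2_mult u v"])
    qed
  qed
  then show ?thesis using A(1) by (auto simp: subcoalgebra_def)
qed

section \<open>Hit actions on products and the wedge argument\<close>

lemma functional_mult_left: "functional f \<Longrightarrow> functional (\<lambda>x. f (a * x))"
  and functional_mult_right: "functional f \<Longrightarrow> functional (\<lambda>x. f (x * a))"
  by (auto intro: functional_compose linear_mult_left linear_mult_right)

text \<open>Expand \<Delta>(xz) as \<Delta>(x)\<Delta>(z) and sum over the legs of \<open>z\<close>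
  first: each first leg \<open>a\<close> of \<open>x\<close> is absorbed into the functional, while
  the second leg stays as a factor.\<close>

lemma lhit_mult_left:
  assumes f: "functional f" and u: "u \<in> \<Delta> x"
  shows "lhit f (x * z) = lin_ext scale (\<lambda>(a, b). b * lhit (\<lambda>c. f (a * c)) z) u"
proof -
  have "lhit f (x * z) = lin_ext scale (\<lambda>(a, b). scale (f a) b) (tensor2_mult u (rep z))"
    by (rule lhit_eq[OF f comult_mult[OF u rep]])
  also have "\<dots> = lin_ext scale (\<lambda>(a, b). lin_ext scale (\<lambda>(c, d). b * scale (f (a * c)) d) (rep z)) u"
    by (simp add: tensor2_mult_def lin_ext_lin_ext case_prod_unfold lin_ext_gen mult_scale_right)
  also have "\<dots> = lin_ext scale (\<lambda>(a, b). b * lhit (\<lambda>c. f (a * c)) z) u"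
    by (simp add: lhit_def linear_lin_ext_self[OF linear_mult_left] case_prod_unfold)
  finally show ?thesis .
qed

lemma lhit_mult_right:
  assumes f: "functional f" and v: "v \<in> \<Delta> z"
  shows "lhit f (x * z) = lin_ext scale (\<lambda>(c, d). lhit (\<lambda>a. f (a * c)) x * d) v"
proof -
  have "lhit f (x * z) = lin_ext scale (\<lambda>(a, b). scale (f a) b) (tensor2_mult (rep x) v)"
    by (rule lhit_eq[OF f comult_mult[OF rep v]])
  also have "\<dots> = lin_ext scale (\<lambda>(a, b). lin_ext scale (\<lambda>(c, d). scale (f (a * c)) b * d) v) (rep x)"
    by (simp add: tensor2_mult_def lin_ext_lin_ext case_prod_unfold lin_ext_gen scale_mult_left)
  also have "\<dots> = lin_ext scale (\<lambda>(c, d). lin_ext scale (\<lambda>(a, b). scale (f (a * c)) b * d) (rep x)) v"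
    unfolding lin_ext_def case_prod_unfold scale_sum_right
    by (subst sum.swap) (simp add: mult.commute)
  also have "\<dots> = lin_ext scale (\<lambda>(c, d). lhit (\<lambda>a. f (a * c)) x * d) v"
    by (simp add: lhit_def linear_lin_ext_self[OF linear_mult_right] case_prod_unfold)
  finally show ?thesis .
qed

text \<open>If \<open>X\<close> lies in the wedge of \<open>X2\<close> and \<open>X1\<close>, then U
  X W lies in the wedge of U X2 W and U X1 W. Expanding the outer factors over \<open>U\<close> and
  \<open>W\<close> leaves the hit action on \<open>X\<close> of functionals
  \<open>\<lambda>t. f (a * (t * c))\<close>.\<close>

lemma lhit_mprod_wedge:
  assumes U: "subcoalgebra scale \<Delta> U" and W: "subcoalgebra scale \<Delta> W"
    and f: "functional f" "\<And>z. z \<in> mprod U (mprod X2 W) \<Longrightarrow> f z = 0"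
    and wedge: "\<And>g x. functional g \<Longrightarrow> (\<And>y. y \<in> X2 \<Longrightarrow> g y = 0) \<Longrightarrow> x \<in> X \<Longrightarrow> lhit g x \<in> X1"
    and z: "z \<in> mprod U (mprod X W)"
  shows "lhit f z \<in> mprod U (mprod X1 W)"
proof -
  have inner: "lhit (\<lambda>c. f (a * c)) y \<in> mprod X1 W" if a: "a \<in> U" and y: "y \<in> mprod X W" for a y
  proof -
    have fa: "functional (\<lambda>c. f (a * c))" by (rule functional_mult_left[OF f(1)])
    have "mprod X W \<subseteq> {y. lhit (\<lambda>c. f (a * c)) y \<in> mprod X1 W}"
    proof (rule mprod_minimal[OF subspace_lhit_preimage[OF _ fa]])
      fix x w assume x: "x \<in> X" and w: "w \<in> W"
      obtain v where v: "v \<in> \<Delta> w" "Poly_Mapping.keys v \<subseteq> W \<times> W"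
        using W w by (auto simp: subcoalgebra_def)
      have "lin_ext scale (\<lambda>(c, d). lhit (\<lambda>t. f (a * (t * c))) x * d) v \<in> mprod X1 W"
      proof (rule lin_ext_in_subspace)
        fix k assume "k \<in> Poly_Mapping.keys v"
        then obtain c d where k: "k = (c, d)" "c \<in> W" "d \<in> W" using v by blast
        have "lhit (\<lambda>t. f (a * (t * c))) x \<in> X1"
          \<comment> \<open>With \<open>a\<close> in \<open>U\<close> and \<open>c\<close> in
            \<open>W\<close>, this functional vanishes on \<open>X2\<close> because \<open>f\<close>
            vanishes on U X2 W.\<close>
          by (rule wedge[OF functional_mult_right[OF fa] _ x]) (auto intro!: f(2) mprodI a k)
        then show "(case k of (c, d) \<Rightarrow> lhit (\<lambda>t. f (a * (t * c))) x * d) \<in> mprod X1 W"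
          using k by (simp add: mprodI)
      qed simp
      then show "x * w \<in> {y. lhit (\<lambda>c. f (a * c)) y \<in> mprod X1 W}"
        by (simp add: lhit_mult_right[OF fa v(1)])
    qed simp
    then show ?thesis using y by blast
  qed
  have "mprod U (mprod X W) \<subseteq> {z. lhit f z \<in> mprod U (mprod X1 W)}"
  proof (rule mprod_minimal[OF subspace_lhit_preimage[OF _ f(1)]])
    fix x y assume x: "x \<in> U" and y: "y \<in> mprod X W"
    obtain u where u: "u \<in> \<Delta> x" "Poly_Mapping.keys u \<subseteq> U \<times> U"
      using U x by (auto simp: subcoalgebra_def)
    have "lin_ext scale (\<lambda>(a, b). b * lhit (\<lambda>c. f (a * c)) y) u \<in> mprod U (mprod X1 W)"
      by (rule lin_ext_in_subspace) (use u inner y in \<open>auto intro!: mprodI\<close>)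
    then show "x * y \<in> {z. lhit f z \<in> mprod U (mprod X1 W)}"
      by (simp add: lhit_mult_left[OF f(1) u(1)])
  qed simp
  then show ?thesis using z by blast
qed

text \<open>Take \<open>X\<close> of least dimension. If it lies in a wedge of \<open>X2\<close> and
  \<open>X1\<close>, then \<open>D\<close> lies in U X2 W or in U X1 W, so minimality gives the
  hypothesis of \<open>prime_imp_simple_subcoalgebra\<close>.\<close>

lemma simple_subcoalgebra_in_mprod:
  assumes D: "simple_subcoalgebra scale \<Delta> D"
    and U: "subcoalgebra scale \<Delta> U" and W: "subcoalgebra scale \<Delta> W"
    and C: "subcoalgebra scale \<Delta> C" "C \<subseteq> span B" "finite B"
    and DC: "D \<subseteq> mprod U (mprod C W)"
  obtains X where "simple_subcoalgebra scale \<Delta> X" "X \<subseteq> C" "D \<subseteq> mprod U (mprod X W)"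
proof -
  have D': "subcoalgebra scale \<Delta> D" "D \<noteq> {0}" using D by (auto simp: simple_subcoalgebra_def)
  note Dsub = subcoalgebra_subspace[OF D'(1)]
  let ?P = "\<lambda>X. subcoalgebra scale \<Delta> X \<and> X \<subseteq> C \<and> D \<subseteq> mprod U (mprod X W)"
  have "?P C" using C DC by blast
  then obtain X where X: "subcoalgebra scale \<Delta> X" "X \<subseteq> C" "D \<subseteq> mprod U (mprod X W)"
    and min: "\<And>Y. ?P Y \<Longrightarrow> dim X \<le> dim Y"
    using ex_has_least_nat[of ?P C dim] by blast
  have XB: "X \<subseteq> span B" using X(2) C(2) by blast
  have min': "Y = X" if "subcoalgebra scale \<Delta> Y" "Y \<subseteq> X" "D \<subseteq> mprod U (mprod Y W)" for Y
  proof (rule ccontr)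
    assume "Y \<noteq> X"
    then have "dim Y < dim X"
      using that dim_psubset_finite[OF subcoalgebra_subspace[OF that(1)] _ XB C(3)] by blast
    moreover have "?P Y" using that X(2) by blast
    ultimately show False using min by (meson linorder_not_less)
  qed
  have "simple_subcoalgebra scale \<Delta> X"
  proof (rule prime_imp_simple_subcoalgebra[OF X(1) XB C(3)])
    show "X \<noteq> {0}"
    proof
      assume X0: "X = {0}"
      have "mprod X W \<subseteq> {0}" by (rule mprod_minimal) (auto simp: X0)
      then have "mprod U (mprod X W) \<subseteq> {0}" by (intro mprod_minimal) auto
      then show False using X(3) D'(2) subspace_0[OF Dsub] by blast
    qed
  next
    fix X1 X2
    assume X1: "subcoalgebra scale \<Delta> X1" "X1 \<subseteq> X" and X2: "subcoalgebra scale \<Delta> X2" "X2 \<subseteq> X"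
      and wedge: "\<And>f x. functional f \<Longrightarrow> (\<And>y. y \<in> X2 \<Longrightarrow> f y = 0) \<Longrightarrow> x \<in> X \<Longrightarrow> lhit f x \<in> X1"
    let ?Z = "mprod U (mprod X2 W)"
    have Z: "subcoalgebra scale \<Delta> ?Z" by (intro subcoalgebra_mprod U W X2)
    show "X1 = X \<or> X2 = X"
    proof (cases "D \<subseteq> ?Z")
      case True
      then show ?thesis using min' X2 by blast
    next
      case False
      \<comment> \<open>By simplicity, so one functional can agree with the counit on
        \<open>D\<close> and vanish on \<open>?Z\<close>: it acts as the identity on
        \<open>D\<close>, yet the wedge sends \<open>D\<close> into U X1 W.\<close>
      then have "D \<inter> ?Z \<subseteq> {0}" using simple_subcoalgebra_subset[OF D Z] by blast
      then obtain f where f: "functional f" "\<And>v. v \<in> D \<Longrightarrow> f v = \<epsilon> v" "\<And>z. z \<in> ?Z \<Longrightarrow> f z = 0"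
        using functional_extension[OF Dsub subcoalgebra_subspace[OF Z] _ functional_counit] by blast
      have "D \<subseteq> mprod U (mprod X1 W)"
      proof
        fix d assume d: "d \<in> D"
        obtain u where u: "u \<in> \<Delta> d" "Poly_Mapping.keys u \<subseteq> D \<times> D"
          using D'(1) d by (auto simp: subcoalgebra_def)
        \<comment> \<open>Only values of the functional on first legs enter, and these can be taken
          in \<open>D\<close>.\<close>
        have "lhit f d = lhit \<epsilon> d"
          unfolding lhit_eq[OF f(1) u(1)] lhit_eq[OF functional_counit u(1)]
          by (rule lin_ext_cong) (use u f(2) in auto)
        then have "lhit f d = d" by simp
        moreover have "lhit f d \<in> mprod U (mprod X1 W)"
          by (rule lhit_mprod_wedge[OF U W f(1,3) wedge]) (use d X(3) in auto)
        ultimately show "d \<in> mprod U (mprod X1 W)" by simp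
      qed
      then show ?thesis using min' X1 by blast
    qed
  qed
  then show ?thesis using that X by blast
qed

section \<open>The coradical of an affine bialgebra\<close>

primrec mpow :: "'h set \<Rightarrow> nat \<Rightarrow> 'h set" where
  "mpow C 0 = span {1}"
| "mpow C (Suc n) = mprod C (mpow C n)"

lemma subcoalgebra_mpow: "subcoalgebra scale \<Delta> C \<Longrightarrow> subcoalgebra scale \<Delta> (mpow C n)"
  by (induction n) (auto intro: subcoalgebra_span_one subcoalgebra_mprod)

lemma subspace_mpow [simp]: "subspace (mpow C n)"
  by (cases n) auto

lemma mprod_one_right: "subspace A \<Longrightarrow> mprod A (span {1}) = A"
proof
  assume A: "subspace A"
  show "mprod A (span {1}) \<subseteq> A"
    by (rule mprod_minimal[OF A]) (auto simp: span_singleton mult_scale_right subspace_scale A)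
  show "A \<subseteq> mprod A (span {1})"
    using mprodI[of _ A 1 "span {1}"] by (auto simp: span_base)
qed

lemma mprod_one_left: "subspace A \<Longrightarrow> mprod (span {1}) A = A"
proof
  assume A: "subspace A"
  show "mprod (span {1}) A \<subseteq> A"
    by (rule mprod_minimal[OF A]) (auto simp: span_singleton scale_mult_left subspace_scale A)
  show "A \<subseteq> mprod (span {1}) A"
    using mprodI[of 1 "span {1}" _ A] by (auto simp: span_base)
qed

lemma mprod_mpow: "mprod (mpow C m) (mpow C n) = mpow C (m + n)"
  by (induction m) (auto simp: mprod_one_left mprod_assoc[symmetric])

lemma mpow_mono:
  assumes "1 \<in> C" "m \<le> n"
  shows "mpow C m \<subseteq> mpow C n"
  using assms(2)
proof (induction n rule: dec_induct)
  case (step n)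
  then show ?case using mprodI[OF assms(1), of _ "mpow C n"] by auto
qed simp

text \<open>With \<open>1 \<in> C\<close> the powers increase, so two elements lie in a common one;
  under multiplication the exponents add.\<close>

lemma subalgebra_UN_mpow:
  assumes "1 \<in> C"
  shows "subalgebra scale (\<Union>n. mpow C n)"
  unfolding subalgebra_def
proof (intro conjI ballI)
  show "subspace (\<Union>n. mpow C n)"
  proof (rule subspaceI)
    fix x y assume "x \<in> (\<Union>n. mpow C n)" "y \<in> (\<Union>n. mpow C n)"
    then obtain m n where "x \<in> mpow C m" "y \<in> mpow C n" by blast
    then have "x \<in> mpow C (max m n)" "y \<in> mpow C (max m n)"
      using mpow_mono[OF assms] by (meson max.cobounded1 max.cobounded2 subsetD)+
    then show "x + y \<in> (\<Union>n. mpow C n)" by (blast intro: subspace_add[OF subspace_mpow])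
  qed (auto intro: subspace_0[OF subspace_mpow] subspace_scale[OF subspace_mpow])
  show "1 \<in> (\<Union>n. mpow C n)" by (auto intro!: exI[of _ 0] span_base)
  fix x y assume "x \<in> (\<Union>n. mpow C n)" "y \<in> (\<Union>n. mpow C n)"
  then obtain m n where "x \<in> mpow C m" "y \<in> mpow C n" by blast
  from mprodI[OF this] show "x * y \<in> (\<Union>n. mpow C n)" unfolding mprod_mpow by blast
qed

text \<open>Induction on the number of factors \<open>C\<close> left, for all \<open>U\<close> at
  once: the leftmost \<open>C\<close> is replaced by a simple \<open>X\<close> inside it, and
  \<open>mprod U X\<close> is the next \<open>U\<close>, still a subcoalgebra in
  \<open>A\<close>.\<close>

lemma simple_subcoalgebra_in_subalgebra:
  assumes D: "simple_subcoalgebra scale \<Delta> D"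
    and C: "subcoalgebra scale \<Delta> C" "C \<subseteq> span B" "finite B"
    and A: "subalgebra scale A" "\<And>X. simple_subcoalgebra scale \<Delta> X \<Longrightarrow> X \<subseteq> C \<Longrightarrow> X \<subseteq> A"
    and U: "subcoalgebra scale \<Delta> U" "U \<subseteq> A"
    and "D \<subseteq> mprod U (mpow C n)"
  shows "D \<subseteq> A"
  using U \<open>D \<subseteq> mprod U (mpow C n)\<close>
proof (induction n arbitrary: U)
  case 0
  then show ?case by (simp add: mprod_one_right subcoalgebra_subspace)
next
  case (Suc n)
  obtain X where X: "simple_subcoalgebra scale \<Delta> X" "X \<subseteq> C" "D \<subseteq> mprod U (mprod X (mpow C n))"
    using simple_subcoalgebra_in_mprod[OF D Suc.prems(1) subcoalgebra_mpow[OF C(1)] C] Suc.prems(3)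
    by auto
  have "subcoalgebra scale \<Delta> (mprod U X)"
    using X Suc.prems by (intro subcoalgebra_mprod) (auto simp: simple_subcoalgebra_def)
  moreover have "mprod U X \<subseteq> A"
    using A(1) A(2)[OF X(1,2)] Suc.prems(2) by (intro mprod_minimal) (auto simp: subalgebra_def)
  ultimately show ?case using Suc.IH X(3) by (simp add: mprod_assoc)
qed

lemma affine_hopf_coradical:
  assumes "affine_algebra scale (UNIV :: 'h set)"
  shows "affine_algebra scale (hopf_coradical scale \<Delta>)"
proof -
  obtain G where G: "finite G" "generated_subalgebra scale G = UNIV"
    using assms by (auto simp: affine_algebra_def)
  obtain C B where C: "subcoalgebra scale \<Delta> C" "insert 1 G \<subseteq> C" "finite B" "C \<subseteq> span B"
    using finite_subcoalgebra_containing[of "insert 1 G"] G(1) by blast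
  have "G \<subseteq> mpow C 1" using C(2) mprod_one_right[OF subcoalgebra_subspace[OF C(1)]] by simp
  then have "generated_subalgebra scale G \<subseteq> (\<Union>n. mpow C n)"
    using C(2) by (intro generated_subalgebra_minimal subalgebra_UN_mpow) blast+
  then have mpow: "\<exists>n. x \<in> mpow C n" for x using G(2) by blast
  \<comment> \<open>\<open>S\<close> lies in the finite-dimensional \<open>C\<close>, so a maximal
    independent subset \<open>E\<close> of it is finite; \<open>E\<close> is the generating set
    sought.\<close>
  define S where "S = \<Union>{X. simple_subcoalgebra scale \<Delta> X \<and> X \<subseteq> C}"
  obtain E where E: "E \<subseteq> S" "independent E" "S \<subseteq> span E"
    using maximal_independent_subset by blast
  have "S \<subseteq> C" by (auto simp: S_def)
  then have finE: "finite E"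
    using independent_span_bound[OF C(3) E(2)] E(1) C(4) by blast
  let ?A = "generated_subalgebra scale E"
  have A: "subalgebra scale ?A" by (rule subalgebra_generated_subalgebra) (rule vector_space_axioms)
  have "span E \<subseteq> ?A"
    using A generated_subalgebra_superset by (intro span_minimal) (auto simp: subalgebra_def)
  then have SA: "S \<subseteq> ?A" using E(3) by blast
  have "D \<subseteq> ?A" if D: "simple_subcoalgebra scale \<Delta> D" for D
  proof -
    have "D \<noteq> {0}" "subspace D" using D by (auto simp: simple_subcoalgebra_def subcoalgebra_def)
    then obtain x where x: "x \<in> D" "x \<noteq> 0" using subspace_0 by blast
    obtain n where n: "x \<in> mpow C n" using mpow by blast
    \<comment> \<open>One nonzero element in a power of \<open>C\<close> suffices, since powers are
      subcoalgebras and \<open>D\<close> is simple.\<close>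
    have "D \<subseteq> mpow C n"
      using simple_subcoalgebra_subset[OF D subcoalgebra_mpow[OF C(1)]] x n by blast
    \<comment> \<open>The scalars serve as the initial \<open>U\<close> of the induction.\<close>
    then have "D \<subseteq> mprod (span {1}) (mpow C n)" by (simp add: mprod_one_left)
    moreover have "span {1} \<subseteq> ?A" using A by (intro span_minimal) (auto simp: subalgebra_def)
    moreover have "X \<subseteq> ?A" if "simple_subcoalgebra scale \<Delta> X" "X \<subseteq> C" for X
      using that SA by (auto simp: S_def)
    ultimately show ?thesis
      by (intro simple_subcoalgebra_in_subalgebra[OF D C(1,4,3) A _ subcoalgebra_span_one])
  qed
  then have "coradical scale \<Delta> \<subseteq> ?A"
    unfolding coradical_def using A by (intro span_minimal) (auto simp: subalgebra_def)
  then have "hopf_coradical scale \<Delta> \<subseteq> ?A"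
    unfolding hopf_coradical_def by (rule generated_subalgebra_minimal[OF A])
  moreover have "S \<subseteq> coradical scale \<Delta>"
    using simple_subcoalgebra_in_coradical unfolding S_def by blast
  then have "E \<subseteq> hopf_coradical scale \<Delta>"
    unfolding hopf_coradical_def
    using E(1) generated_subalgebra_superset[of "coradical scale \<Delta>" scale] by simp
  then have "?A \<subseteq> hopf_coradical scale \<Delta>"
    unfolding hopf_coradical_def
    by (intro generated_subalgebra_minimal subalgebra_generated_subalgebra vector_space_axioms)
  ultimately show ?thesis using finE unfolding affine_algebra_def by blast
qed

lemma subcoalgebra_hopf_coradical: "subcoalgebra scale \<Delta> (hopf_coradical scale \<Delta>)"
  unfolding hopf_coradical_def
  by (intro subcoalgebra_generated_subalgebra subcoalgebra_coradical)

lemma subalgebra_hopf_coradical: "subalgebra scale (hopf_coradical scale \<Delta>)"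
  unfolding hopf_coradical_def
  by (intro subalgebra_generated_subalgebra vector_space_axioms)

end

theorem theoremA:
  fixes scale :: "'k::field \<Rightarrow> 'h::ring_1 \<Rightarrow> 'h"
    and \<Delta> :: "'h \<Rightarrow> (('h \<times> 'h) \<Rightarrow>\<^sub>0 'k) set"
    and \<epsilon> :: "'h \<Rightarrow> 'k"
    and S :: "'h \<Rightarrow> 'h"
  assumes "hopf_algebra scale \<Delta> \<epsilon> S"
    and "affine_algebra scale UNIV"
  shows "(hopf_subalgebra scale \<Delta> S (hopf_coradical scale \<Delta>)
            \<longleftrightarrow> S ` hopf_coradical scale \<Delta> \<subseteq> hopf_coradical scale \<Delta>)
       \<and> (hopf_subalgebra scale \<Delta> S (hopf_coradical scale \<Delta>)
            \<longrightarrow> affine_algebra scale (hopf_coradical scale \<Delta>))"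
proof -
  interpret hopf_algebra scale \<Delta> \<epsilon> S by fact
  \<comment> \<open>The Hopf coradical is a subalgebra by construction and a subcoalgebra because
    the coradical is one, so being a Hopf subalgebra reduces to stability under
    \<open>S\<close>.\<close>
  show ?thesis
    using affine_hopf_coradical[OF assms(2)] subcoalgebra_hopf_coradical subalgebra_hopf_coradical
    by (simp add: hopf_subalgebra_def)
qed

end
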